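(* Given any triangulated closed pseudo 3-manifold $(M,\mathbf T)$ and any $k:E\to\mathbf S^1$ satisfying $\prod_{e\in E}k(e)=1$ and, for each vertex $v\in V$, $\prod_{e>v}k(e)=1$, one has $SAS(\mathbf T,k)\neq\emptyset$. Furthermore, $SAS(\mathbf T,k)$ is a smooth closed manifold of dimension $|\chi(M)|+|T|$.
   Context: Let $X$ be a disjoint union of finitely many oriented Euclidean tetrahedra, and identify the codimension-1 faces of $X$ in pairs by affine homeomorphisms. The quotient $M$ is a closed pseudo 3-manifold, and the images of the simplices of $X$ form its triangulation $\mathbf T$ (simplices need not be embedded in $M$). $V,E,T$ are the sets of vertices, edges and tetrahedra of $\mathbf T$. $|T|$ is the number of tetrahedra, $\chi(M)$ is the Euler characteristic of $M$, and $|\chi(M)|$ is its absolute value. For an edge $e$ and a vertex $v$, $e>v$ means that $v$ is a face (i.e. a vertex) of $e$. An edge $e\in E$ is regarded as an equivalence class of edges $e^*$ of the tetrahedra of $X$ (those identified to $e$). In a tetrahedron there are, up to normal isotopy (isotopy leaving each simplex invariant), three normal quadrilaterals, one for each pair of opposite edges (the quadrilateral is disjoint from exactly these two edges). $\Box$ is the set of all normal isotopy classes of normal quadrilaterals in the tetrahedra of $\mathbf T$; $q\subset\sigma$ means that $q$ lies in the tetrahedron $\sigma$. For $q\in\Box$, $e\in E$, the index $i(q,e)\in\{0,1,2\}$ is the number of edges $e^*$ in the class $e$ that lie in the same tetrahedron of $X$ as $q$ and are disjoint from $q$. Let $\mathbf S^1$ be the unit circle in $\mathbb C$. $SAS(\mathbf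 T,k)$, the set of $\mathbf S^1$-valued angle structures with curvature $k$, is the set of all $x:\Box\to\mathbf S^1$ such that $\prod_{q\in\Box,\,q\subset\sigma}x(q)=-1$ for each $\sigma\in T$ and $\prod_{q\in\Box}x(q)^{i(q,e)}=k(e)$ for each $e\in E$.
   Formalization: M is taken connected, no edge may be identified with its own reversal, and in the product over e>v a loop at v counts twice; without each of these the claim as written fails. *)

theory Defs
  imports "HOL-Analysis.Analysis"
begin

section \<open>Triangulated closed pseudo 3-manifolds\<close>

text \<open>
  The finite type \<open>'t\<close> is the set of tetrahedra of \<open>X\<close>. The vertices of the tetrahedron \<open>t\<close> are the
  pairs \<open>(t, i)\<close> with \<open>i :: 4\<close>, and a simplex of \<open>X\<close> is represented by its set of vertices; distinct
  tetrahedra are disjoint, so the vertex set determines the simplex. The orientations of the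
  tetrahedra are not recorded: they can be chosen freely (the face identifications are not required
  to reverse them) and angle structures do not depend on them.
\<close>

type_synonym 't vertex = "'t \<times> 4"

definition tet :: "'t \<Rightarrow> 't vertex set" where
  "tet t = {t} \<times> UNIV"

definition simplices :: "nat \<Rightarrow> 't vertex set set" where
  "simplices n = {s. (\<exists>t. s \<subseteq> tet t) \<and> card s = n + 1}"

text \<open>
  An affine homeomorphism between triangles is the same thing as a bijection between their vertices.
  A face pairing \<open>\<phi>\<close> gives for each triangle \<open>f\<close> of \<open>X\<close> the vertex map \<open>\<phi> f\<close> of the affine
  homeomorphism from \<open>f\<close> onto its partner, which is the triangle \<open>\<phi> f ` f\<close>. The values of \<open>\<phi> f\<close>
  off \<open>f\<close> are irrelevant.
\<close>

type_synonym 't pairing = "'t vertex set \<Rightarrow> 't vertex \<Rightarrow> 't vertex"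

definition face_pairing :: "'t pairing \<Rightarrow> bool" where
  "face_pairing \<phi> \<longleftrightarrow> (\<forall>f \<in> simplices 2.
     inj_on (\<phi> f) f \<and> \<phi> f ` f \<in> simplices 2 \<and> \<phi> f ` f \<noteq> f \<and>
     (\<forall>v\<in>f. \<phi> (\<phi> f ` f) (\<phi> f v) = v))"

text \<open>
  The relation \<open>glued\<close> is symmetric for a face pairing, so its reflexive transitive closure is the
  equivalence relation on the simplices of \<open>X\<close> that \<open>\<phi>\<close> generates. Hence \<open>cells \<phi> 0\<close>, \<open>cells \<phi> 1\<close>,
  \<open>cells \<phi> 2\<close>, \<open>cells \<phi> 3\<close> are the sets of vertices, edges, triangles and tetrahedra of the
  triangulation, each given as an equivalence class of simplices of \<open>X\<close>.
\<close>

definition glued :: "'t pairing \<Rightarrow> ('t vertex set \<times> 't vertex set) set" where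
  "glued \<phi> = {(s, \<phi> f ` s) | f s. f \<in> simplices 2 \<and> s \<subseteq> f \<and> s \<noteq> {}}"

definition cells :: "'t pairing \<Rightarrow> nat \<Rightarrow> 't vertex set set set" where
  "cells \<phi> n = simplices n // (glued \<phi>)\<^sup>*"

definition euler_char :: "'t pairing \<Rightarrow> int" where
  "euler_char \<phi> = (\<Sum>n\<le>3. (- 1) ^ n * int (card (cells \<phi> n)))"

text \<open>
  Pseudo-manifolds are connected. As tetrahedra meet only along glued faces, the quotient is
  connected exactly if any two tetrahedra are joined by a chain of glued faces.
\<close>

definition connected_pairing :: "'t pairing \<Rightarrow> bool" where
  "connected_pairing \<phi> \<longleftrightarrow>
     (\<forall>t t'. (t, t') \<in> {(u, u'). \<exists>f \<in> simplices 2. f \<subseteq> tet u \<and> \<phi> f ` f \<subseteq> tet u'}\<^sup>*)"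

text \<open>
  No edge of \<open>X\<close> is identified with itself by the reflection that swaps its endpoints: such an edge
  would be folded at its midpoint, and its image in the quotient would not be a 1-cell. This makes
  every open simplex of \<open>X\<close> embed in the quotient (no condition is needed in dimensions 0, 2, 3), so
  that the cells triangulate the quotient and \<open>euler_char\<close> is its Euler characteristic. The condition
  holds automatically if all face identifications reverse orientation.
\<close>

definition unfolded_edges :: "'t pairing \<Rightarrow> bool" where
  "unfolded_edges \<phi> \<longleftrightarrow> (\<forall>v w. {v, w} \<in> simplices 1 \<longrightarrow>
     ((v, w), (w, v)) \<notin> {((a, b), (\<phi> f a, \<phi> f b)) | f a b. f \<in> simplices 2 \<and> a \<in> f \<and> b \<in> f}\<^sup>*)"

definition triangulated_closed_pseudo_3_manifold :: "'t pairing \<Rightarrow> bool" where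
  "triangulated_closed_pseudo_3_manifold \<phi> \<longleftrightarrow>
     face_pairing \<phi> \<and> connected_pairing \<phi> \<and> unfolded_edges \<phi>"

text \<open>
  The number of ends of the edge \<open>e\<close> at the vertex \<open>v\<close>, computed on any representative of \<open>e\<close>. It is
  positive iff \<open>v\<close> is a face of \<open>e\<close>, and it is 2 if \<open>e\<close> is a loop at \<open>v\<close>. Products over the edges
  \<open>e > v\<close> count \<open>e\<close> with this multiplicity.
\<close>

definition ends :: "'t vertex set set \<Rightarrow> 't vertex set set \<Rightarrow> nat" where
  "ends e v = card {w \<in> (SOME a. a \<in> e). {w} \<in> v}"


section \<open>Normal quadrilaterals and angle structures\<close>

text \<open>
  The normal isotopy classes of quadrilaterals in one tetrahedron are named after the pairs of
  opposite edges disjoint from them. So \<open>'t \<times> quad\<close> is the set of all normal quadrilateral types, and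
  \<open>(t, q)\<close> lies in the tetrahedron \<open>t\<close>.
\<close>

datatype quad = Q01_23 | Q02_13 | Q03_12

instance quad :: finite
proof
  have "(UNIV :: quad set) \<subseteq> {Q01_23, Q02_13, Q03_12}"
    using quad.exhaust by auto
  then show "finite (UNIV :: quad set)"
    by (rule finite_subset) simp
qed

fun disjoint_edges :: "quad \<Rightarrow> 4 set set" where
  "disjoint_edges Q01_23 = {{0, 1}, {2, 3}}"
| "disjoint_edges Q02_13 = {{0, 2}, {1, 3}}"
| "disjoint_edges Q03_12 = {{0, 3}, {1, 2}}"

fun quad_index :: "'t \<times> quad \<Rightarrow> 't vertex set set \<Rightarrow> nat" where
  "quad_index (t, q) e = card {a \<in> e. \<exists>s \<in> disjoint_edges q. a = {t} \<times> s}"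

definition SAS :: "'t::finite pairing \<Rightarrow> ('t vertex set set \<Rightarrow> complex) \<Rightarrow> (complex ^ ('t \<times> quad)) set"
  where
  "SAS \<phi> k = {x. (\<forall>q. x $ q \<in> sphere 0 1) \<and>
     (\<forall>t. (\<Prod>q\<in>UNIV. x $ (t, q)) = - 1) \<and>
     (\<forall>e \<in> cells \<phi> 1. (\<Prod>q\<in>UNIV. x $ q ^ quad_index q e) = k e)}"


section \<open>Smooth closed manifolds\<close>

text \<open>For an open set \<open>U\<close>, \<open>Ck_on n U f\<close> says that \<open>f\<close> is of class \<open>C\<^sup>n\<close> on \<open>U\<close>.\<close>

primrec Ck_on ::
  "nat \<Rightarrow> 'a::euclidean_space set \<Rightarrow> ('a \<Rightarrow> 'b::euclidean_space) \<Rightarrow> bool" where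
  "Ck_on 0 U f \<longleftrightarrow> continuous_on U f"
| "Ck_on (Suc n) U f \<longleftrightarrow> (\<forall>x\<in>U. f differentiable (at x)) \<and>
     (\<forall>v. Ck_on n U (\<lambda>x. frechet_derivative f (at x) v))"

definition smooth_on :: "'a::euclidean_space set \<Rightarrow> ('a \<Rightarrow> 'b::euclidean_space) \<Rightarrow> bool" where
  "smooth_on U f \<longleftrightarrow> (\<forall>n. Ck_on n U f)"

definition diffeomorphism ::
  "'a::euclidean_space set \<Rightarrow> 'b::euclidean_space set \<Rightarrow> ('a \<Rightarrow> 'b) \<Rightarrow> ('b \<Rightarrow> 'a) \<Rightarrow> bool" where
  "diffeomorphism U W f g \<longleftrightarrow>
     open U \<and> open W \<and> homeomorphism U W f g \<and> smooth_on U f \<and> smooth_on W g"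

text \<open>
  An embedded smooth \<open>d\<close>-manifold without boundary: around each of its points an ambient chart
  flattens \<open>S\<close> to an open piece of a \<open>d\<close>-dimensional linear subspace.
\<close>

definition smooth_submanifold :: "nat \<Rightarrow> 'a::euclidean_space set \<Rightarrow> bool" where
  "smooth_submanifold d S \<longleftrightarrow> (\<forall>p\<in>S. \<exists>U (W :: 'a set) L f g.
     p \<in> U \<and> diffeomorphism U W f g \<and> subspace L \<and> dim L = d \<and> f ` (S \<inter> U) = L \<inter> W)"

definition smooth_closed_manifold :: "nat \<Rightarrow> 'a::euclidean_space set \<Rightarrow> bool" where
  "smooth_closed_manifold d S \<longleftrightarrow> compact S \<and> smooth_submanifold d S"

end

theory Submission
  imports Defs "HOL-Complex_Analysis.Cauchy_Integral_Formula" "HOL-Library.Z2"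
begin

text \<open>
  Write \<open>V\<close>, \<open>E\<close>, \<open>T\<close> for the numbers of vertices, edges and tetrahedra. In terms of arguments, the
  defining equations are linear: the map \<open>angle_sums\<close> sends a real weight on the quadrilaterals to
  its sums over the tetrahedra and to its sums around the edges, weighted by the indices. A covector
  \<open>z\<close> on tetrahedra and edges kills its image if and only if, in each tetrahedron, the values of \<open>z\<close>
  at the two edges of an opposite pair have the same sum for all three pairs (it is minus the value
  at the tetrahedron). Then \<open>z\<close> has the form \<open>u i + u j\<close> on the edge \<open>ij\<close>, where \<open>u i\<close> can be computed
  from any triangle at the vertex \<open>i\<close>; hence \<open>u\<close> is compatible with the gluings and is a function on
  the vertices of the triangulation (\<open>angle_relations\<close>). So the rank is \<open>T + E - V\<close> and the kernel
  has dimension \<open>3 T - (T + E - V) = 2 T - E + V\<close>. As there are \<open>2 T\<close> triangles, \<open>\<chi>(M) = V - E + T\<close>,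
  and the kernel has dimension \<open>\<chi>(M) + T\<close>.

  Moreover \<open>\<chi>(M) \<ge> 0\<close>, that is \<open>E \<le> V + T\<close>: the vertex links are \<open>V\<close> connected closed surfaces, made
  of \<open>4 T\<close> triangles with \<open>6 T\<close> edges and \<open>2 E\<close> vertices, and a connected closed surface has Euler
  characteristic at most 2. The last fact is proved by counting cochains over the field with two
  elements, which needs no orientation (\<open>card_edges_le\<close>).

  For the existence of a solution, choose real arguments of the numbers \<open>k e\<close>, and a half turn for
  each tetrahedron. They lie in the image of \<open>angle_sums\<close> if they are orthogonal to the relation of
  each vertex. The hypotheses on \<open>k\<close> make the defects at the vertices integers with an even sum; here
  one uses that a vertex link has an even number of triangles. Since \<open>M\<close> is connected, every integer
  vector on the vertices with an even sum is an integer combination of edges, an edge being the sum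
  of its two ends (\<open>edge_lattice_even\<close>). Thus a change of the arguments by integers removes the
  defects (\<open>SAS_nonempty\<close>).

  Finally, near a solution \<open>p\<close> the coordinatewise logarithm of \<open>x / p\<close> is an ambient chart; it takes
  the solutions to the purely imaginary vectors whose imaginary part is in the kernel of
  \<open>angle_sums\<close>, because small weights have angle sums smaller than a full turn.
\<close>

section \<open>Linear algebra and counting\<close>

lemma dim_kernel_plus_range:
  fixes f :: "'a::euclidean_space \<Rightarrow> 'b::euclidean_space"
  assumes f: "linear f"
  shows "dim {x. f x = 0} + dim (range f) = DIM('a)"
proof -
  define K where "K = {x. f x = 0}"
  define P where "P = {y. \<forall>x\<in>K. orthogonal x y}"
  have K: "subspace K"
    unfolding K_def by (rule linear_subspace_kernel[OF f])
  have P: "subspace P"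
    unfolding P_def using subspace_orthogonal_to_vectors[of K] by (simp add: orthogonal_commute)
  have "dim P + dim K = DIM('a)"
    using dim_subspace_orthogonal_to_vectors[OF K subspace_UNIV] by (simp add: P_def)
  moreover have "f ` P = range f"
  proof (rule subset_antisym, blast, rule subsetI)
    fix y assume "y \<in> range f"
    then obtain x where x: "y = f x" by blast
    obtain a b where ab: "a \<in> span K" "\<And>w. w \<in> span K \<Longrightarrow> orthogonal b w" "x = a + b"
      using orthogonal_subspace_decomp_exists[of K x] by metis
    have "a \<in> K" using ab(1) K by (simp add: span_eq_iff[THEN iffD2])
    then have "y = f b" using x ab(3) f by (simp add: linear_add K_def)
    moreover have "b \<in> P"
      unfolding P_def using ab(2) by (auto simp: orthogonal_commute span_base)
    ultimately show "y \<in> f ` P" by blast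
  qed
  moreover have "inj_on f (span P)"
  proof (rule inj_onI)
    fix x y assume xy: "x \<in> span P" "y \<in> span P" "f x = f y"
    have "span P = P" using P by (simp add: span_eq_iff[THEN iffD2])
    then have "x - y \<in> P" using xy P subspace_diff by metis
    moreover have "x - y \<in> K" using xy(3) f by (simp add: K_def linear_diff)
    ultimately have "orthogonal (x - y) (x - y)" unfolding P_def by blast
    then show "x = y" by (simp add: orthogonal_def)
  qed
  then have "dim (f ` P) = dim P" using f by (rule dim_image_eq[rotated])
  ultimately show ?thesis unfolding K_def by simp
qed

lemma dim_supported:
  "dim {x :: real^'n. \<forall>i. i \<notin> d \<longrightarrow> x $ i = 0} = card d"
  using dim_substandard_cart[where 'a=real and d=d] by (simp add: dim_vec_eq)

text \<open>The homomorphism theorem, for a homomorphism defined on a finite subgroup \<open>A\<close>.\<close>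

lemma card_hom_kernel_image:
  fixes \<delta> :: "'a::ab_group_add \<Rightarrow> 'b::ab_group_add"
  assumes fin: "finite A" and diff: "\<And>x y. x \<in> A \<Longrightarrow> y \<in> A \<Longrightarrow> x - y \<in> A"
    and hom: "\<And>x y. x \<in> A \<Longrightarrow> y \<in> A \<Longrightarrow> \<delta> (x - y) = \<delta> x - \<delta> y"
  shows "card A = card {a\<in>A. \<delta> a = 0} * card (\<delta> ` A)"
proof -
  have add: "x + y \<in> A" if "x \<in> A" "y \<in> A" for x y
    using diff[of x "0 - y"] diff[of 0 y] diff[of y y] that by simp
  have hom_add: "\<delta> (x + y) = \<delta> x + \<delta> y" if "x \<in> A" "y \<in> A" for x y
    using hom[of "x + y" y] add that by simp
  have fibre: "card {a\<in>A. \<delta> a = \<delta> b} = card {a\<in>A. \<delta> a = 0}" if b: "b \<in> A" for b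
  proof (rule bij_betw_same_card[of "\<lambda>a. a - b"], rule bij_betw_byWitness[where f'="\<lambda>a. a + b"])
    show "(\<lambda>a. a - b) ` {a \<in> A. \<delta> a = \<delta> b} \<subseteq> {a \<in> A. \<delta> a = 0}"
      using b diff hom by auto
    show "(\<lambda>a. a + b) ` {a \<in> A. \<delta> a = 0} \<subseteq> {a \<in> A. \<delta> a = \<delta> b}"
      using b add hom_add by auto
  qed auto
  have "card A = (\<Sum>y\<in>\<delta> ` A. card {a\<in>A. \<delta> a = y})"
    using sum.image_gen[OF fin, of "\<lambda>_. 1::nat" \<delta>] by simp
  also have "\<dots> = (\<Sum>y\<in>\<delta> ` A. card {a\<in>A. \<delta> a = 0})"
    by (rule sum.cong) (auto simp: fibre)
  finally show ?thesis by simp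
qed

text \<open>The orbits of an involution without fixed points have two elements.\<close>

lemma card_involution_orbits:
  assumes fin: "finite S" and inv: "\<And>x. x \<in> S \<Longrightarrow> \<iota> x \<in> S \<and> \<iota> x \<noteq> x \<and> \<iota> (\<iota> x) = x"
  shows "2 * card ((\<lambda>x. {x, \<iota> x}) ` S) = card S"
proof -
  have U: "\<Union> ((\<lambda>x. {x, \<iota> x}) ` S) = S" using inv by auto
  have "2 * card ((\<lambda>x. {x, \<iota> x}) ` S) = card (\<Union> ((\<lambda>x. {x, \<iota> x}) ` S))"
  proof (rule card_partition)
    fix c assume "c \<in> (\<lambda>x. {x, \<iota> x}) ` S"
    then obtain x where "x \<in> S" "c = {x, \<iota> x}" by blast
    then show "card c = 2" using inv[of x] by (auto simp: card_2_iff)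
  next
    fix c d assume "c \<in> (\<lambda>x. {x, \<iota> x}) ` S" "d \<in> (\<lambda>x. {x, \<iota> x}) ` S" and ne: "c \<noteq> d"
    then obtain x y where xy: "x \<in> S" "c = {x, \<iota> x}" "y \<in> S" "d = {y, \<iota> y}" by blast
    show "c \<inter> d = {}"
    proof (rule ccontr)
      assume "c \<inter> d \<noteq> {}"
      then have "x = y \<or> x = \<iota> y \<or> \<iota> x = y \<or> \<iota> x = \<iota> y" using xy by auto
      then have "c = d" using xy inv[of x] inv[of y] by (metis insert_commute)
      with ne show False by simp
    qed
  qed (use fin U in auto)
  then show ?thesis using U by simp
qed

text \<open>
  Over the field with two elements, a function on \<open>S\<close> that is constant on the classes of an
  equivalence relation is given by the set of classes where it is 1.
\<close>

lemma card_class_functions: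
  fixes S :: "'n::finite set"
  assumes R: "equiv S R"
  shows "card {h :: bit^'n. (\<forall>x. x \<notin> S \<longrightarrow> h $ x = 0) \<and> (\<forall>(x, y)\<in>R. h $ x = h $ y)}
    = 2 ^ card (S // R)" (is "card ?H = _")
proof -
  have R_S: "x \<in> S \<and> y \<in> S" if "(x, y) \<in> R" for x y
    using that R by (meson equiv_class_eq_iff)
  have "bij_betw (\<lambda>h. {X \<in> S // R. \<exists>x\<in>X. h $ x = 1}) ?H (Pow (S // R))"
  proof (rule bij_betw_byWitness[where f'="\<lambda>P. \<chi> x. if x \<in> \<Union>P then 1 else 0"])
    show "\<forall>h\<in>?H. (\<chi> x. if x \<in> \<Union>{X \<in> S // R. \<exists>x\<in>X. h $ x = 1} then 1 else 0) = h"
    proof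
      fix h assume h: "h \<in> ?H"
      have *: "x \<in> \<Union>{X \<in> S // R. \<exists>x\<in>X. h $ x = 1} \<longleftrightarrow> h $ x = 1" for x
      proof
        assume "x \<in> \<Union>{X \<in> S // R. \<exists>x\<in>X. h $ x = 1}"
        then obtain X y where X: "X \<in> S // R" "x \<in> X" "y \<in> X" "h $ y = 1" by blast
        then have "(y, x) \<in> R" using R by (meson quotient_eq_iff)
        then have "h $ y = h $ x" using h by blast
        with X show "h $ x = 1" by simp
      next
        assume 1: "h $ x = 1"
        then have "x \<in> S" using h by fastforce
        then have "x \<in> R `` {x}" "R `` {x} \<in> S // R"
          using equiv_class_self[OF R] quotientI[of x S R] by blast+
        then show "x \<in> \<Union>{X \<in> S // R. \<exists>x\<in>X. h $ x = 1}" using 1 by blast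
      qed
      show "(\<chi> x. if x \<in> \<Union>{X \<in> S // R. \<exists>x\<in>X. h $ x = 1} then 1 else 0) = h"
        unfolding vec_eq_iff vec_lambda_beta * by (auto simp: bit_not_one_iff)
    qed
    show "\<forall>P\<in>Pow (S // R).
        {X \<in> S // R. \<exists>x\<in>X. (\<chi> x. if x \<in> \<Union>P then (1::bit) else 0) $ x = 1} = P"
    proof (intro ballI equalityI subsetI)
      fix P X assume P: "P \<in> Pow (S // R)"
        and "X \<in> {X \<in> S // R. \<exists>x\<in>X. (\<chi> x. if x \<in> \<Union>P then (1::bit) else 0) $ x = 1}"
      then obtain x Y where "X \<in> S // R" "x \<in> X" "x \<in> Y" "Y \<in> P"
        by (auto split: if_splits)
      then show "X \<in> P" using P R quotient_disj[of S R X Y] by blast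
    next
      fix P X assume P: "P \<in> Pow (S // R)" and X: "X \<in> P"
      then obtain x where "x \<in> X" using R in_quotient_imp_non_empty by blast
      then show "X \<in> {X \<in> S // R. \<exists>x\<in>X. (\<chi> x. if x \<in> \<Union>P then (1::bit) else 0) $ x = 1}"
        using X P by auto
    qed
    show "(\<lambda>P. \<chi> x. if x \<in> \<Union>P then 1 else 0) ` Pow (S // R) \<subseteq> ?H"
    proof clarify
      fix P assume P: "P \<subseteq> S // R"
      have "x \<in> S" if "x \<in> \<Union>P" for x
        using that P R in_quotient_imp_subset by blast
      moreover have "x \<in> \<Union>P \<longleftrightarrow> y \<in> \<Union>P" if "(x, y) \<in> R" for x y
      proof -
        have "x \<in> X \<longleftrightarrow> y \<in> X" if "X \<in> P" for X
          using in_quotient_imp_closed[OF R, of X] P that \<open>(x, y) \<in> R\<close> R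
          by (meson equivE subsetD symE)
        then show ?thesis by blast
      qed
      ultimately show "(\<forall>x. x \<notin> S \<longrightarrow> (\<chi> x. if x \<in> \<Union>P then (1::bit) else 0) $ x = 0) \<and>
          (\<forall>(x, y)\<in>R. (\<chi> x. if x \<in> \<Union>P then (1::bit) else 0) $ x
            = (\<chi> x. if x \<in> \<Union>P then 1 else 0) $ y)"
        by auto
    qed
  qed blast
  then have "card ?H = card (Pow (S // R))" by (rule bij_betw_same_card)
  then show ?thesis by (simp add: card_Pow)
qed

section \<open>Coordinatewise holomorphic maps are smooth\<close>

lemma Ck_on_cong:
  assumes U: "open U" and eq: "\<And>x. x \<in> U \<Longrightarrow> f x = g x" and f: "Ck_on n U f"
  shows "Ck_on n U g"
  using eq f
proof (induction n arbitrary: f g)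
  case 0
  then show ?case by (simp cong: continuous_on_cong)
next
  case (Suc n)
  have der: "f differentiable (at x)" if "x \<in> U" for x
    using Suc.prems(2) that by simp
  have g: "(g has_derivative frechet_derivative f (at x)) (at x)" if "x \<in> U" for x
  proof (rule has_derivative_transform_within_open[OF _ U that])
    show "(f has_derivative frechet_derivative f (at x)) (at x)"
      using der[OF that] frechet_derivative_works by blast
  qed (rule Suc.prems(1))
  then have "frechet_derivative f (at x) = frechet_derivative g (at x)" if "x \<in> U" for x
    using frechet_derivative_at that by blast
  then have "Ck_on n U (\<lambda>x. frechet_derivative g (at x) v)" for v
    using Suc.IH[of "\<lambda>x. frechet_derivative f (at x) v"] Suc.prems(2) by simp
  then show ?case using g by (auto simp: differentiable_def)
qed

lemma has_derivative_coordinatewise: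
  fixes h :: "'n::finite \<Rightarrow> complex \<Rightarrow> complex"
  assumes "\<And>q. (h q has_field_derivative d q) (at (x $ q))"
  shows "((\<lambda>x. \<chi> q. h q (x $ q)) has_derivative (\<lambda>v. \<chi> q. v $ q * d q)) (at x)"
proof (subst has_derivative_componentwise_within, rule ballI)
  fix i :: "complex^'n" assume "i \<in> Basis"
  then obtain q u where i: "i = axis q u" by (auto simp: Basis_vec_def)
  have "((\<lambda>x::complex^'n. h q (x $ q)) has_derivative (\<lambda>v. d q * v $ q)) (at x)"
    by (rule has_derivative_compose[of "\<lambda>x. x $ q" "\<lambda>v. v $ q" x UNIV "h q" "\<lambda>v. d q * v"])
      (use assms[of q] in \<open>auto simp: has_field_derivative_def
        intro!: bounded_linear_imp_has_derivative\<close>)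
  then have "((\<lambda>x::complex^'n. h q (x $ q) \<bullet> u) has_derivative (\<lambda>v. (v $ q * d q) \<bullet> u)) (at x)"
    using bounded_linear.has_derivative[OF bounded_linear_inner_left] by (simp add: mult.commute)
  then show "((\<lambda>x. (\<chi> q. h q (x $ q)) \<bullet> i) has_derivative (\<lambda>v. (\<chi> q. v $ q * d q) \<bullet> i)) (at x)"
    by (simp add: i inner_axis)
qed

lemma smooth_on_coordinatewise_holomorphic:
  fixes h :: "'n::finite \<Rightarrow> complex \<Rightarrow> complex"
  assumes U: "open U" and S: "\<And>q. open (S q)" and US: "\<And>x q. x \<in> U \<Longrightarrow> x $ q \<in> S q"
    and h: "\<And>q. h q holomorphic_on S q"
  shows "smooth_on U (\<lambda>x. \<chi> q. h q (x $ q))"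
proof -
  have "Ck_on n U (\<lambda>x. \<chi> q. h q (x $ q))" for n
    using h
  proof (induction n arbitrary: h)
    case 0
    have "continuous_on U (\<lambda>x. h q (x $ q))" for q
    proof (rule continuous_on_compose2[of "S q" "h q"])
      show "continuous_on (S q) (h q)" by (rule holomorphic_on_imp_continuous_on[OF 0])
      show "continuous_on U (\<lambda>x. x $ q)" by (rule continuous_on_component[OF continuous_on_id])
      show "(\<lambda>x. x $ q) ` U \<subseteq> S q" using US by (rule image_subsetI)
    qed
    then show ?case unfolding Ck_on.simps by (rule continuous_on_vec_lambda)
  next
    case (Suc n)
    have d: "((\<lambda>x. \<chi> q. h q (x $ q)) has_derivative (\<lambda>v. \<chi> q. v $ q * deriv (h q) (x $ q))) (at x)"
      if "x \<in> U" for x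
      by (rule has_derivative_coordinatewise, rule holomorphic_derivI[OF Suc.prems S US[OF that]])
    have "Ck_on n U (\<lambda>x. frechet_derivative (\<lambda>x. \<chi> q. h q (x $ q)) (at x) v)" for v
    proof (rule Ck_on_cong[OF U])
      show "Ck_on n U (\<lambda>x. \<chi> q. v $ q * deriv (h q) (x $ q))"
      proof (rule Suc.IH)
        show "(\<lambda>z. v $ q * deriv (h q) z) holomorphic_on S q" for q
          by (intro holomorphic_on_mult holomorphic_on_const holomorphic_deriv Suc.prems S)
      qed
      show "(\<chi> q. v $ q * deriv (h q) (x $ q)) = frechet_derivative (\<lambda>x. \<chi> q. h q (x $ q)) (at x) v"
        if "x \<in> U" for x
        by (rule fun_cong[OF frechet_derivative_at[OF d[OF that]]])
    qed
    then show ?case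
      unfolding Ck_on.simps using d differentiableI by blast
  qed
  then show ?thesis by (simp add: smooth_on_def)
qed

section \<open>The cell structure\<close>

lemma UNIV_4_from_0: "(UNIV :: 4 set) = {0, 1, 2, 3}"
proof -
  have *: "(4::4) = 0" by simp
  show ?thesis unfolding UNIV_4 * by blast
qed

text \<open>The triangle of \<open>X\<close> opposite to a given vertex; every triangle is of this form for exactly one vertex.\<close>

definition opp :: "'t vertex \<Rightarrow> 't vertex set" where
  "opp c = tet (fst c) - {c}"

lemma mem_tet [simp]: "c \<in> tet t \<longleftrightarrow> fst c = t"
  by (cases c) (auto simp: tet_def)

lemma card_tet [simp]: "card (tet t) = 4"
  by (simp add: tet_def card_cartesian_product)

lemma finite_tet [simp]: "finite (tet t)"
  by (simp add: tet_def)

lemma mem_opp [simp]: "b \<in> opp c \<longleftrightarrow> fst b = fst c \<and> b \<noteq> c"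
  by (auto simp: opp_def)

lemma inj_opp: "inj opp"
proof (rule injI)
  fix b c :: "'t vertex"
  assume eq: "opp b = opp c"
  have "card (opp b) = 3" by (simp add: opp_def)
  then have "opp b \<noteq> {}" by auto
  then obtain a where "a \<in> opp b" by blast
  then have "fst b = fst c" using eq by (metis mem_opp)
  then show "b = c" using eq by (metis mem_opp)
qed

lemma simplices_0: "simplices 0 = range (\<lambda>c. {c})"
proof (intro equalityI subsetI)
  fix s :: "'t vertex set" assume "s \<in> range (\<lambda>c. {c})"
  then obtain c where "s = {c}" by blast
  then have "s \<subseteq> tet (fst c)" "card s = 0 + 1" by simp_all
  then show "s \<in> simplices 0" unfolding simplices_def by blast
qed (auto simp: simplices_def card_1_singleton_iff)

lemma simplices_1: "simplices 1 = {{a, b} | a b. fst a = fst b \<and> a \<noteq> b}"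
proof (intro equalityI subsetI)
  fix e :: "'t vertex set" assume "e \<in> simplices 1"
  then obtain t where t: "e \<subseteq> tet t" "card e = 2" by (auto simp: simplices_def)
  then obtain a b where ab: "e = {a, b}" "a \<noteq> b" by (auto simp: card_2_iff)
  then have "fst a = fst b" using t(1) by simp
  then show "e \<in> {{a, b} | a b. fst a = fst b \<and> a \<noteq> b}" using ab by blast
next
  fix e :: "'t vertex set" assume "e \<in> {{a, b} | a b. fst a = fst b \<and> a \<noteq> b}"
  then obtain a b where ab: "e = {a, b}" "fst a = fst b" "a \<noteq> b" by blast
  then have "e \<subseteq> tet (fst a)" "card e = 1 + 1" by simp_all
  then show "e \<in> simplices 1" unfolding simplices_def by blast
qed

lemma simplices_2: "simplices 2 = range opp"
proof (intro equalityI subsetI)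
  fix f :: "'t vertex set" assume "f \<in> simplices 2"
  then obtain t where t: "f \<subseteq> tet t" "card f = 3" by (auto simp: simplices_def)
  then have "card (tet t - f) = 1" by (simp add: card_Diff_subset finite_subset[OF t(1)])
  then obtain c where c: "tet t - f = {c}" by (auto simp: card_1_singleton_iff)
  then have "fst c = t" by (metis DiffD1 insertI1 mem_tet)
  then have "f = opp c" using t(1) c unfolding opp_def by blast
  then show "f \<in> range opp" by simp
next
  fix f :: "'t vertex set" assume "f \<in> range opp"
  then obtain c where c: "f = opp c" by blast
  then have "f \<subseteq> tet (fst c)" "card f = 2 + 1" by (auto simp: opp_def)
  then show "f \<in> simplices 2" unfolding simplices_def by blast
qed

lemma simplices_3: "simplices 3 = range tet"
proof (intro equalityI subsetI)
  fix f :: "'t vertex set" assume "f \<in> simplices 3"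
  then obtain t where t: "f \<subseteq> tet t" "card f = 4" by (auto simp: simplices_def)
  then have "f = tet t" by (simp add: card_subset_eq)
  then show "f \<in> range tet" by simp
next
  fix f :: "'t vertex set" assume "f \<in> range tet"
  then obtain t where "f = tet t" by blast
  then have "f \<subseteq> tet t" "card f = 3 + 1" by simp_all
  then show "f \<in> simplices 3" unfolding simplices_def by blast
qed

lemma card_triangle: "f \<in> simplices 2 \<Longrightarrow> card f = 3"
  by (simp add: simplices_def)

lemma card_image_opp: "card (opp ` A) = card A"
  by (rule card_image[OF inj_on_subset[OF inj_opp subset_UNIV]])

lemma triangles_at_edge:
  assumes "fst a = fst b" "a \<noteq> b"
  shows "card {f \<in> simplices 2. a \<in> f \<and> b \<in> f} = 2"
proof -
  have "{f \<in> simplices 2. a \<in> f \<and> b \<in> f} = opp ` {c. a \<in> opp c \<and> b \<in> opp c}"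
    unfolding simplices_2 by blast
  also have "{c. a \<in> opp c \<and> b \<in> opp c} = tet (fst a) - {a, b}"
    using assms by auto
  also have "card (opp ` (tet (fst a) - {a, b})) = 2"
    unfolding card_image_opp using assms by (subst card_Diff_subset) auto
  finally show ?thesis .
qed

lemma triangles_at_vertex: "card {f \<in> simplices 2. a \<in> f} = 3"
proof -
  have "{f \<in> simplices 2. a \<in> f} = opp ` {c. a \<in> opp c}"
    unfolding simplices_2 by blast
  also have "{c. a \<in> opp c} = tet (fst a) - {a}"
    by auto
  also have "card (opp ` (tet (fst a) - {a})) = 3"
    unfolding card_image_opp by (subst card_Diff_subset) auto
  finally show ?thesis .
qed

lemma card_triangles: "card (simplices 2 :: 't::finite vertex set set) = 4 * CARD('t)"
proof -
  have "card (range (opp :: 't vertex \<Rightarrow> _)) = CARD('t vertex)"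
    by (rule card_image[OF inj_opp])
  then show ?thesis by (simp add: simplices_2)
qed

lemma third_vertex:
  obtains c :: "'t vertex" where "fst c = fst a" "c \<noteq> a" "c \<noteq> b"
proof -
  have "card (tet (fst a) - {a, b}) \<ge> 4 - card {a, b}"
    using diff_card_le_card_Diff[of "{a, b}" "tet (fst a)"] by simp
  moreover have "card {a, b} \<le> 2" by (simp add: card_insert_if)
  ultimately have "card (tet (fst a) - {a, b}) \<noteq> 0" by linarith
  then have "tet (fst a) - {a, b} \<noteq> {}" by (metis card.empty)
  then obtain c where "c \<in> tet (fst a) - {a, b}" by blast
  then show ?thesis using that by (metis DiffD1 DiffD2 insertCI mem_tet)
qed

lemma triangle_vertices_in_tet: "f \<in> simplices 2 \<Longrightarrow> a \<in> f \<Longrightarrow> b \<in> f \<Longrightarrow> fst a = fst b"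
  by (auto simp: simplices_2)

lemma triangle_through:
  assumes "fst a = fst b" "fst a = fst c" "a \<noteq> b" "a \<noteq> c" "b \<noteq> c"
  shows "{a, b, c} \<in> simplices 2"
proof -
  have "{a, b, c} \<subseteq> tet (fst a)" "card {a, b, c} = 2 + 1" using assms by auto
  then show ?thesis unfolding simplices_def by blast
qed

text \<open>A face pairing alone; connectedness and unfolded edges are assumed where they matter.\<close>

locale paired_faces =
  fixes \<phi> :: "'t::finite pairing"
  assumes pairing: "face_pairing \<phi>"
begin

lemma
  assumes "f \<in> simplices 2"
  shows inj_on_face: "inj_on (\<phi> f) f"
    and partner: "\<phi> f ` f \<in> simplices 2"
    and partner_neq: "\<phi> f ` f \<noteq> f"
    and partner_inverse: "v \<in> f \<Longrightarrow> \<phi> (\<phi> f ` f) (\<phi> f v) = v"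
  using pairing[unfolded face_pairing_def, rule_format, OF assms] by blast+

lemma partner_partner:
  assumes "f \<in> simplices 2"
  shows "\<phi> (\<phi> f ` f) ` (\<phi> f ` f) = f"
proof -
  have "(\<lambda>v. \<phi> (\<phi> f ` f) (\<phi> f v)) ` f = (\<lambda>v. v) ` f"
    by (intro image_cong refl partner_inverse[OF assms])
  then show ?thesis by (simp only: image_image image_ident)
qed

lemma glued_sym: "sym (glued \<phi>)"
proof (rule symI)
  fix s s' assume "(s, s') \<in> glued \<phi>"
  then obtain f where f: "f \<in> simplices 2" "s \<subseteq> f" "s \<noteq> {}" "s' = \<phi> f ` s"
    unfolding glued_def by blast
  have "s' = \<phi> f ` s" "\<And>v. v \<in> s \<Longrightarrow> \<phi> (\<phi> f ` f) (\<phi> f v) = v"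
    using f partner_inverse by blast+
  then have "\<phi> (\<phi> f ` f) ` s' = (\<lambda>v. v) ` s"
    unfolding \<open>s' = \<phi> f ` s\<close> image_image by (intro image_cong refl)
  then have "s = \<phi> (\<phi> f ` f) ` s'" by (simp only: image_ident)
  moreover have "s' \<subseteq> \<phi> f ` f" "s' \<noteq> {}" using f by auto
  ultimately show "(s', s) \<in> glued \<phi>" using partner[OF f(1)] unfolding glued_def by blast
qed

text \<open>The cell of the quotient that a simplex of \<open>X\<close> is mapped to.\<close>

definition cell :: "'t vertex set \<Rightarrow> 't vertex set set" where
  "cell s = (glued \<phi>)\<^sup>* `` {s}"

lemma equiv_glued: "equiv UNIV ((glued \<phi>)\<^sup>*)"
proof (rule equivI)
  show "sym ((glued \<phi>)\<^sup>*)" by (rule sym_rtrancl[OF glued_sym])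
qed (simp_all only: refl_rtrancl trans_rtrancl subset_UNIV UNIV_Times_UNIV)

lemma cell_eq_iff: "cell s = cell s' \<longleftrightarrow> (s, s') \<in> (glued \<phi>)\<^sup>*"
  unfolding cell_def by (rule eq_equiv_class_iff[OF equiv_glued]) simp_all

lemma mem_cell: "s' \<in> cell s \<longleftrightarrow> cell s' = cell s"
proof -
  have "s' \<in> cell s \<longleftrightarrow> cell s = cell s'" unfolding cell_eq_iff by (simp add: cell_def)
  also have "\<dots> \<longleftrightarrow> cell s' = cell s" by (rule eq_commute)
  finally show ?thesis .
qed

lemma cells_eq: "cells \<phi> n = cell ` simplices n"
  unfolding cells_def quotient_def cell_def by blast

lemma cell_face:
  assumes "f \<in> simplices 2" "s \<subseteq> f" "s \<noteq> {}"
  shows "cell (\<phi> f ` s) = cell s"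
proof -
  have "(s, \<phi> f ` s) \<in> glued \<phi>" using assms unfolding glued_def by blast
  then have "cell s = cell (\<phi> f ` s)" unfolding cell_eq_iff by (rule r_into_rtrancl)
  then show ?thesis by (rule sym)
qed

text \<open>An equality of cells is used by checking an invariant on a single gluing step.\<close>

lemma cell_invariant:
  assumes "\<And>f s. f \<in> simplices 2 \<Longrightarrow> s \<subseteq> f \<Longrightarrow> s \<noteq> {} \<Longrightarrow> P (\<phi> f ` s) = P s"
    and "cell s = cell s'"
  shows "P s = P s'"
proof -
  have "(s, s') \<in> (glued \<phi>)\<^sup>*" using assms(2) by (simp add: cell_eq_iff)
  then show ?thesis
  proof induction
    case (step y z)
    then obtain f where f: "f \<in> simplices 2" "y \<subseteq> f" "y \<noteq> {}" "z = \<phi> f ` y"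
      unfolding glued_def by blast
    show ?case using step.IH assms(1)[OF f(1-3)] f(4) by simp
  qed (rule refl)
qed

lemma simplices_glued:
  assumes "f \<in> simplices 2" "s \<subseteq> f"
  shows "\<phi> f ` s \<in> simplices n \<longleftrightarrow> s \<in> simplices n"
proof -
  have "card (\<phi> f ` s) = card s"
    using inj_on_face[OF assms(1)] assms(2) by (meson card_image inj_on_subset)
  moreover obtain c d where "f = opp c" "\<phi> f ` f = opp d"
    using assms(1) partner[OF assms(1)] by (auto simp: simplices_2)
  then have "f \<subseteq> tet (fst c)" "\<phi> f ` f \<subseteq> tet (fst d)" by auto
  then have "s \<subseteq> tet (fst c)" "\<phi> f ` s \<subseteq> tet (fst d)" using assms(2) by blast+
  ultimately show ?thesis by (auto simp: simplices_def)
qed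

lemma cell_in_cells: "cell s \<in> cells \<phi> n \<longleftrightarrow> s \<in> simplices n"
proof
  assume "cell s \<in> cells \<phi> n"
  then obtain s' where "s' \<in> simplices n" "cell s = cell s'" by (auto simp: cells_eq)
  then show "s \<in> simplices n"
    using cell_invariant[of "\<lambda>s. s \<in> simplices n" s s'] simplices_glued by simp
qed (auto simp: cells_eq)

lemma mem_cells_eq:
  assumes "e \<in> cells \<phi> n" "s \<in> e" shows "e = cell s"
  using assms by (auto simp: cells_eq mem_cell)

subsection \<open>Counting cells\<close>

lemma card_cells_3: "card (cells \<phi> 3) = CARD('t)"
proof -
  have "cell (tet t) = {tet t}" for t
  proof -
    have "(tet t, s) \<notin> glued \<phi>" for s
    proof
      assume "(tet t, s) \<in> glued \<phi>"
      then obtain f where "f \<in> simplices 2" "tet t \<subseteq> f" by (auto simp: glued_def)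
      then show False
        using card_mono[of f "tet t"] card_triangle[of f] by (simp add: finite_subset[of f])
    qed
    then have "s = tet t" if "(tet t, s) \<in> (glued \<phi>)\<^sup>*" for s
      using that \<open>\<And>s. (tet t, s) \<notin> glued \<phi>\<close> by (auto elim: converse_rtranclE)
    then show ?thesis by (auto simp: cell_def)
  qed
  moreover have "inj (tet :: 't \<Rightarrow> 't vertex set)"
    by (rule injI) (metis mem_tet prod.sel(1))
  ultimately have "inj (\<lambda>t. cell (tet t))" by (simp add: inj_def)
  then show ?thesis by (simp add: cells_eq simplices_3 image_image card_image)
qed

lemma card_cells_2: "card (cells \<phi> 2) = 2 * CARD('t)"
proof -
  have "cell f = {f, \<phi> f ` f}" if f: "f \<in> simplices 2" for f
  proof (intro equalityI subsetI)
    fix g assume "g \<in> cell f"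
    then have "(f, g) \<in> (glued \<phi>)\<^sup>*" by (simp add: cell_def)
    then show "g \<in> {f, \<phi> f ` f}"
    proof induction
      case (step g h)
      have g: "g \<in> simplices 2" using step.IH f partner by auto
      obtain f' where f': "f' \<in> simplices 2" "g \<subseteq> f'" "h = \<phi> f' ` g"
        using step.hyps by (auto simp: glued_def)
      then have "g = f'" using g by (simp add: card_subset_eq card_triangle finite_subset)
      then show ?case using step.IH f' f partner_partner by auto
    qed simp
  next
    have "cell (\<phi> f ` f) = cell f" using cell_face[OF f] f card_triangle[OF f] by force
    then show "g \<in> cell f" if "g \<in> {f, \<phi> f ` f}" for g using that by (auto simp: mem_cell)
  qed
  then have "cells \<phi> 2 = (\<lambda>f. {f, \<phi> f ` f}) ` simplices 2"
    unfolding cells_eq by (intro image_cong) auto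
  moreover have "2 * card ((\<lambda>f. {f, \<phi> f ` f}) ` simplices 2)
      = card (simplices 2 :: 't vertex set set)"
    by (rule card_involution_orbits) (auto simp: partner partner_neq partner_partner)
  ultimately show ?thesis by (simp add: card_triangles)
qed

lemma euler_char_eq:
  "euler_char \<phi> = int (card (cells \<phi> 0)) - int (card (cells \<phi> 1)) + int CARD('t)"
proof -
  have "{..3::nat} = {0, 1, 2, 3}" by auto
  then show ?thesis by (simp add: euler_char_def card_cells_2 card_cells_3)
qed

end

text \<open>The dimension in \<open>cells \<phi> 1\<close> is kept as the numeral 1.\<close>

declare One_nat_def [simp del]

lemma UNIV_quad: "(UNIV :: quad set) = {Q01_23, Q02_13, Q03_12}"
  using quad.exhaust by auto

lemma finite_disjoint_edges [simp]: "finite (disjoint_edges q)"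
  by (cases q) auto

lemma sum_disjoint_edges:
  fixes w :: "4 \<Rightarrow> real"
  shows "(\<Sum>s\<in>disjoint_edges q. \<Sum>i\<in>s. w i) = (\<Sum>i\<in>UNIV. w i)"
proof -
  have two: "(\<Sum>s\<in>{{a, b}, {c, d}}. \<Sum>i\<in>s. w i) = w a + w b + w c + w d"
    if "a \<noteq> b" "c \<noteq> d" "a \<noteq> c" "a \<noteq> d" for a b c d
  proof -
    have "{a, b} \<noteq> {c, d}" using that by blast
    then show ?thesis using that by simp
  qed
  have all: "(\<Sum>i\<in>UNIV. w i) = w 0 + w 1 + w 2 + w 3"
    unfolding UNIV_4_from_0 by simp
  show ?thesis
    unfolding all by (cases q) (simp_all only: disjoint_edges.simps, subst two, simp_all,
      subst two, simp_all, subst two, simp_all)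
qed

lemma disjoint_edge_pair:
  assumes "s \<in> disjoint_edges q"
  obtains i j where "i \<noteq> j" "s = {i, j}"
proof -
  have "\<forall>s\<in>disjoint_edges q. card s = 2" by (cases q) simp_all
  then have "card s = 2" using assms by blast
  then obtain i j where "s = {i, j}" "i \<noteq> j" unfolding card_2_iff by blast
  then show ?thesis by (rule that[rotated])
qed

text \<open>
  Numbers on the edges of a tetrahedron with the same sum on each pair of opposite edges come from
  numbers at the vertices; the latter are unique, and computed from any triangle at the vertex.
\<close>

lemma edge_weights_from_vertices:
  fixes Z :: "4 \<Rightarrow> 4 \<Rightarrow> real"
  assumes sym: "\<And>i j. Z i j = Z j i"
    and s: "Z 0 1 + Z 2 3 = s" "Z 0 2 + Z 1 3 = s" "Z 0 3 + Z 1 2 = s"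
  obtains u where "\<And>i j. i \<noteq> j \<Longrightarrow> Z i j = u i + u j"
proof
  define u where "u i = (if i = 0 then (Z 0 1 + Z 0 2 - Z 1 2) / 2
    else if i = 1 then (Z 0 1 + Z 1 2 - Z 0 2) / 2
    else if i = 2 then (Z 0 2 + Z 1 2 - Z 0 1) / 2
    else Z 0 3 - (Z 0 1 + Z 0 2 - Z 1 2) / 2)" for i :: 4
  fix i j :: 4
  assume ij: "i \<noteq> j"
  have "i \<in> {0, 1, 2, 3}" "j \<in> {0, 1, 2, 3}" using UNIV_4_from_0 by blast+
  then show "Z i j = u i + u j"
    using ij s sym[of 1 0] sym[of 2 0] sym[of 3 0] sym[of 2 1] sym[of 3 1] sym[of 3 2]
    unfolding u_def by (elim insertE emptyE) (simp_all add: field_simps)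
qed

context paired_faces
begin

subsection \<open>Incidence of vertices, edges and quadrilaterals\<close>

lemma cell_vertex: "f \<in> simplices 2 \<Longrightarrow> a \<in> f \<Longrightarrow> cell {\<phi> f a} = cell {a}"
  using cell_face[of f "{a}"] by simp

lemma cell_edge: "f \<in> simplices 2 \<Longrightarrow> a \<in> f \<Longrightarrow> b \<in> f \<Longrightarrow> cell {\<phi> f a, \<phi> f b} = cell {a, b}"
  using cell_face[of f "{a, b}"] by simp

lemma vertex_in_cells [simp]: "cell {a} \<in> cells \<phi> 0"
  unfolding cell_in_cells simplices_0 by blast

lemma edge_in_cells: "fst a = fst b \<Longrightarrow> a \<noteq> b \<Longrightarrow> cell {a, b} \<in> cells \<phi> 1"
  unfolding cell_in_cells simplices_1 by blast

lemma mem_vertex: "v \<in> cells \<phi> 0 \<Longrightarrow> {a} \<in> v \<longleftrightarrow> cell {a} = v"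
  unfolding cells_eq using mem_cell by blast

lemma ends_edge:
  assumes ab: "fst a = fst b" "a \<noteq> b" and v: "v \<in> cells \<phi> 0"
  shows "ends (cell {a, b}) v = of_bool (cell {a} = v) + of_bool (cell {b} = v)"
proof -
  define P where "P s = card {w \<in> s. {w} \<in> v}" for s
  have P: "P (\<phi> f ` s) = P s" if f: "f \<in> simplices 2" "s \<subseteq> f" for f s
  proof -
    have "{w \<in> \<phi> f ` s. {w} \<in> v} = \<phi> f ` {w \<in> s. {w} \<in> v}"
    proof -
      have "{\<phi> f w} \<in> v \<longleftrightarrow> {w} \<in> v" if "w \<in> s" for w
        using cell_vertex[OF f(1) subsetD[OF f(2) that]] mem_vertex[OF v] by simp
      then show ?thesis by blast
    qed
    moreover have "inj_on (\<phi> f) {w \<in> s. {w} \<in> v}"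
      by (rule inj_on_subset[OF inj_on_face[OF f(1)]]) (use f(2) in blast)
    ultimately show ?thesis unfolding P_def by (simp add: card_image)
  qed
  have "{a, b} \<in> cell {a, b}" by (simp add: mem_cell)
  then have "(SOME s. s \<in> cell {a, b}) \<in> cell {a, b}" by (rule someI)
  then have "cell (SOME s. s \<in> cell {a, b}) = cell {a, b}" by (simp add: mem_cell)
  then have "P (SOME s. s \<in> cell {a, b}) = P {a, b}"
    using cell_invariant[of P] P by blast
  then have "ends (cell {a, b}) v = P {a, b}" by (simp add: ends_def P_def)
  moreover have "{w \<in> {a, b}. {w} \<in> v} = (if cell {a} = v then {a} else {}) \<union> (if cell {b} = v then {b} else {})"
    by (auto simp: mem_vertex[OF v])
  ultimately show ?thesis using ab(2) by (auto simp: P_def)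
qed

lemma sum_ends:
  fixes u :: "'t vertex set set \<Rightarrow> 'b::comm_semiring_1"
  assumes "fst a = fst b" "a \<noteq> b"
  shows "(\<Sum>v\<in>cells \<phi> 0. of_nat (ends (cell {a, b}) v) * u v) = u (cell {a}) + u (cell {b})"
proof -
  have "(\<Sum>v\<in>cells \<phi> 0. of_nat (ends (cell {a, b}) v) * u v)
      = (\<Sum>v\<in>cells \<phi> 0. (if cell {a} = v then u v else 0) + (if cell {b} = v then u v else 0))"
    by (rule sum.cong) (auto simp: ends_edge[OF assms] algebra_simps)
  also have "\<dots> = u (cell {a}) + u (cell {b})"
    by (simp add: sum.distrib sum.delta')
  finally show ?thesis .
qed

lemma disjoint_edge_in_cells:
  assumes "s \<in> disjoint_edges q"
  shows "cell ({t} \<times> s) \<in> cells \<phi> 1"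
proof -
  obtain i j where "i \<noteq> j" "s = {i, j}" using disjoint_edge_pair[OF assms] .
  then have "{t} \<times> s = {(t, i), (t, j)}" "(t, i) \<noteq> (t, j)" by auto
  then show ?thesis using edge_in_cells[of "(t, i)" "(t, j)"] by simp
qed

text \<open>
  Summing over edge classes with the indices of a quadrilateral amounts to summing over the two edges
  disjoint from it. If both lie in one class, the index is 2.
\<close>

lemma sum_quad_index:
  fixes h :: "'t vertex set set \<Rightarrow> real"
  shows "(\<Sum>e\<in>cells \<phi> 1. real (quad_index (t, q) e) * h e) = (\<Sum>s\<in>disjoint_edges q. h (cell ({t} \<times> s)))"
proof -
  have idx: "real (quad_index (t, q) e) * h e
      = (\<Sum>s\<in>disjoint_edges q. if cell ({t} \<times> s) = e then h e else 0)"
    if e: "e \<in> cells \<phi> 1" for e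
  proof -
    have "{a \<in> e. \<exists>s\<in>disjoint_edges q. a = {t} \<times> s} = (\<lambda>s. {t} \<times> s) ` {s \<in> disjoint_edges q. {t} \<times> s \<in> e}"
      by blast
    moreover have "inj_on (\<lambda>s. {t} \<times> s) {s \<in> disjoint_edges q. {t} \<times> s \<in> e}"
      by (rule inj_onI) blast
    moreover have "{s \<in> disjoint_edges q. {t} \<times> s \<in> e} = {s \<in> disjoint_edges q. cell ({t} \<times> s) = e}"
      using e mem_cells_eq[of e 1] mem_cell by blast
    ultimately have "quad_index (t, q) e = card {s \<in> disjoint_edges q. cell ({t} \<times> s) = e}"
      by (simp add: card_image)
    then show ?thesis by (simp add: sum.If_cases Int_def)
  qed
  have "(\<Sum>e\<in>cells \<phi> 1. real (quad_index (t, q) e) * h e)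
      = (\<Sum>e\<in>cells \<phi> 1. \<Sum>s\<in>disjoint_edges q. if cell ({t} \<times> s) = e then h e else 0)"
    by (rule sum.cong[OF refl idx])
  also have "\<dots> = (\<Sum>s\<in>disjoint_edges q. \<Sum>e\<in>cells \<phi> 1. if cell ({t} \<times> s) = e then h e else 0)"
    by (rule sum.swap)
  also have "\<dots> = (\<Sum>s\<in>disjoint_edges q. h (cell ({t} \<times> s)))"
    by (rule sum.cong) (auto simp: disjoint_edge_in_cells)
  finally show ?thesis .
qed

lemma constant_on_vertex_cells:
  assumes "\<And>f a. f \<in> simplices 2 \<Longrightarrow> a \<in> f \<Longrightarrow> w (\<phi> f a) = w a" and "cell {a} = cell {b}"
  shows "w a = w b"
proof -
  have "w ` {a} = w ` {b}"
  proof (rule cell_invariant[OF _ assms(2)])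
    fix f s :: "'t vertex set" assume fs: "f \<in> simplices 2" "s \<subseteq> f"
    show "w ` \<phi> f ` s = w ` s"
      unfolding image_image by (rule image_cong[OF refl assms(1)[OF fs(1) subsetD[OF fs(2)]]])
  qed
  then show ?thesis by simp
qed

lemma vertex_function:
  fixes u :: "'t vertex \<Rightarrow> 'b::zero"
  assumes "\<And>f a. f \<in> simplices 2 \<Longrightarrow> a \<in> f \<Longrightarrow> u (\<phi> f a) = u a"
  obtains w where "\<And>a. w (cell {a}) = u a" "\<And>v. v \<notin> cells \<phi> 0 \<Longrightarrow> w v = 0"
proof
  define w where "w v = (if v \<in> cells \<phi> 0 then u (SOME a. {a} \<in> v) else 0)" for v
  show "w v = 0" if "v \<notin> cells \<phi> 0" for v using that by (simp add: w_def)
  show "w (cell {a}) = u a" for a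
  proof -
    have "{a} \<in> cell {a}" by (simp add: mem_cell)
    then have "{SOME b. {b} \<in> cell {a}} \<in> cell {a}" by (rule someI)
    then have "cell {SOME b. {b} \<in> cell {a}} = cell {a}" by (simp add: mem_cell)
    then have "u (SOME b. {b} \<in> cell {a}) = u a"
      using constant_on_vertex_cells[of u, OF assms] by blast
    then show ?thesis by (simp add: w_def)
  qed
qed

section \<open>The linear system for the angles\<close>

text \<open>
  The coordinate at \<open>Inl t\<close> is the sum over the tetrahedron \<open>t\<close>, the one at \<open>Inr e\<close> the sum around the
  edge \<open>e\<close>. Sets of simplices that are not edges of the triangulation get coordinate 0, so that the
  target lies in the subspace \<open>supported\<close>.
\<close>

definition angle_sums :: "real ^ ('t \<times> quad) \<Rightarrow> real ^ ('t + 't vertex set set)" where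
  "angle_sums \<theta> = (\<chi> i. case i of Inl t \<Rightarrow> \<Sum>q\<in>UNIV. \<theta> $ (t, q)
     | Inr e \<Rightarrow> if e \<in> cells \<phi> 1 then \<Sum>q\<in>UNIV. real (quad_index q e) * \<theta> $ q else 0)"

text \<open>
  The relation between the angle sums that belongs to a real function \<open>u\<close> on the vertices: the sum of
  \<open>u\<close> over the ends of each edge, and minus the sum of \<open>u\<close> over the vertices of each tetrahedron.
\<close>

definition vertex_relation :: "real ^ ('t vertex set set) \<Rightarrow> real ^ ('t + 't vertex set set)" where
  "vertex_relation u = (\<chi> i. case i of Inl t \<Rightarrow> - (\<Sum>c\<in>tet t. u $ cell {c})
     | Inr e \<Rightarrow> if e \<in> cells \<phi> 1 then \<Sum>v\<in>cells \<phi> 0. real (ends e v) * u $ v else 0)"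

text \<open>The vectors on the tetrahedra and edges, extended by 0 to all indices.\<close>

definition supported :: "(real ^ ('t + 't vertex set set)) set" where
  "supported = {z. \<forall>e. e \<notin> cells \<phi> 1 \<longrightarrow> z $ Inr e = 0}"

lemma linear_angle_sums: "linear angle_sums"
  by (rule linearI)
    (auto simp: angle_sums_def vec_eq_iff sum.distrib sum_distrib_left algebra_simps split: sum.splits)

lemma linear_vertex_relation: "linear vertex_relation"
  by (rule linearI)
    (auto simp: vertex_relation_def vec_eq_iff sum.distrib sum_distrib_left algebra_simps split: sum.splits)

lemma subspace_supported: "subspace supported"
  by (auto simp: supported_def subspace_def)

lemma dim_supported_cells: "dim supported = CARD('t) + card (cells \<phi> 1)"
proof -
  have "supported = {z. \<forall>i. i \<notin> range Inl \<union> Inr ` cells \<phi> 1 \<longrightarrow> z $ i = 0}"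
    unfolding supported_def split_sum_all by blast
  moreover have "card (range Inl \<union> Inr ` cells \<phi> 1 :: ('t + 't vertex set set) set) = CARD('t) + card (cells \<phi> 1)"
    by (subst card_Un_disjoint) (auto simp: card_image)
  ultimately show ?thesis by (simp only: dim_supported)
qed

lemma angle_sums_inner:
  assumes z: "z \<in> supported"
  shows "angle_sums \<theta> \<bullet> z = (\<Sum>(t, q)\<in>UNIV. \<theta> $ (t, q) * (z $ Inl t + (\<Sum>s\<in>disjoint_edges q. z $ Inr (cell ({t} \<times> s)))))"
proof -
  have "angle_sums \<theta> \<bullet> z = (\<Sum>i\<in>UNIV. angle_sums \<theta> $ i * z $ i)"
    by (simp add: inner_vec_def)
  also have "\<dots> = (\<Sum>t\<in>UNIV. angle_sums \<theta> $ Inl t * z $ Inl t) + (\<Sum>e\<in>UNIV. angle_sums \<theta> $ Inr e * z $ Inr e)"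
    unfolding UNIV_Plus_UNIV[symmetric] by (subst sum.Plus) (simp_all add: comp_def)
  also have "(\<Sum>t\<in>UNIV. angle_sums \<theta> $ Inl t * z $ Inl t) = (\<Sum>(t, q)\<in>UNIV. \<theta> $ (t, q) * z $ Inl t)"
    by (simp add: angle_sums_def sum_distrib_right sum.cartesian_product flip: UNIV_Times_UNIV)
  also have "(\<Sum>e\<in>UNIV. angle_sums \<theta> $ Inr e * z $ Inr e)
      = (\<Sum>e\<in>cells \<phi> 1. \<Sum>p\<in>UNIV. real (quad_index p e) * \<theta> $ p * z $ Inr e)"
    by (rule sum.mono_neutral_cong_right) (auto simp: angle_sums_def sum_distrib_right)
  also have "\<dots> = (\<Sum>p\<in>UNIV. \<Sum>e\<in>cells \<phi> 1. real (quad_index p e) * \<theta> $ p * z $ Inr e)"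
    by (rule sum.swap)
  also have "\<dots> = (\<Sum>p\<in>UNIV. \<theta> $ p * (\<Sum>e\<in>cells \<phi> 1. real (quad_index p e) * z $ Inr e))"
    by (simp add: sum_distrib_left mult_ac)
  also have "\<dots> = (\<Sum>(t, q)\<in>UNIV. \<theta> $ (t, q) * (\<Sum>s\<in>disjoint_edges q. z $ Inr (cell ({t} \<times> s))))"
    by (rule sum.cong[OF refl]) (simp only: split_paired_all case_prod_conv sum_quad_index)
  finally show ?thesis by (simp add: sum.distrib[symmetric] case_prod_unfold distrib_left)
qed

lemma orthogonal_angle_sums_iff:
  assumes z: "z \<in> supported"
  shows "(\<forall>\<theta>. angle_sums \<theta> \<bullet> z = 0)
    \<longleftrightarrow> (\<forall>t q. z $ Inl t + (\<Sum>s\<in>disjoint_edges q. z $ Inr (cell ({t} \<times> s))) = 0)" (is "_ \<longleftrightarrow> ?R")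
proof
  assume L: "\<forall>\<theta>. angle_sums \<theta> \<bullet> z = 0"
  show ?R
  proof (intro allI)
    fix t q
    have "0 = angle_sums (axis (t, q) 1) \<bullet> z" using L by simp
    also have "\<dots> = (\<Sum>p\<in>UNIV. if p = (t, q) then (z $ Inl (fst p) + (\<Sum>s\<in>disjoint_edges (snd p). z $ Inr (cell ({fst p} \<times> s)))) else 0)"
      unfolding angle_sums_inner[OF z] by (rule sum.cong) (auto simp: axis_def prod_eq_iff case_prod_unfold)
    also have "\<dots> = z $ Inl t + (\<Sum>s\<in>disjoint_edges q. z $ Inr (cell ({t} \<times> s)))"
      by simp
    finally show "z $ Inl t + (\<Sum>s\<in>disjoint_edges q. z $ Inr (cell ({t} \<times> s))) = 0" by simp
  qed
next
  assume ?R
  then show "\<forall>\<theta>. angle_sums \<theta> \<bullet> z = 0"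
    unfolding angle_sums_inner[OF z] by (simp add: case_prod_unfold)
qed

lemma vertex_relation_edge:
  assumes "fst a = fst b" "a \<noteq> b"
  shows "vertex_relation u $ Inr (cell {a, b}) = u $ cell {a} + u $ cell {b}"
  using sum_ends[OF assms, of "\<lambda>v. u $ v"] edge_in_cells[OF assms]
  by (simp add: vertex_relation_def)

lemma sum_tet: "(\<Sum>c\<in>tet t. w c) = (\<Sum>i\<in>UNIV. w (t, i))"
proof -
  have "tet t = Pair t ` UNIV" by (auto simp: tet_def)
  then show ?thesis by (simp add: sum.reindex inj_on_def)
qed

lemma vertex_relation_supported: "vertex_relation u \<in> supported"
  by (simp add: vertex_relation_def supported_def)

lemma vertex_relation_orthogonal: "angle_sums \<theta> \<bullet> vertex_relation u = 0"
proof -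
  have "vertex_relation u $ Inl t + (\<Sum>s\<in>disjoint_edges q. vertex_relation u $ Inr (cell ({t} \<times> s))) = 0"
    for t q
  proof -
    have "vertex_relation u $ Inr (cell ({t} \<times> s)) = (\<Sum>i\<in>s. u $ cell {(t, i)})"
      if s: "s \<in> disjoint_edges q" for s
    proof -
      obtain i j where ij: "i \<noteq> j" "s = {i, j}" using disjoint_edge_pair[OF s] .
      then have "{t} \<times> s = {(t, i), (t, j)}" by auto
      then show ?thesis using ij vertex_relation_edge[of "(t, i)" "(t, j)" u] by simp
    qed
    then have "(\<Sum>s\<in>disjoint_edges q. vertex_relation u $ Inr (cell ({t} \<times> s))) = (\<Sum>i\<in>UNIV. u $ cell {(t, i)})"
      unfolding sum_disjoint_edges[of "\<lambda>i. u $ cell {(t, i)}" q, symmetric] by (rule sum.cong[OF refl])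
    then show ?thesis by (simp add: vertex_relation_def sum_tet)
  qed
  then show ?thesis using orthogonal_angle_sums_iff[OF vertex_relation_supported] by blast
qed

text \<open>All linear relations between the angle sums come from functions on the vertices.\<close>

lemma angle_relations:
  "{z \<in> supported. \<forall>\<theta>. angle_sums \<theta> \<bullet> z = 0}
    = vertex_relation ` {u. \<forall>v. v \<notin> cells \<phi> 0 \<longrightarrow> u $ v = 0}"
proof (intro equalityI subsetI)
  fix z assume "z \<in> {z \<in> supported. \<forall>\<theta>. angle_sums \<theta> \<bullet> z = 0}"
  then have z: "z \<in> supported"
    and rel: "\<And>t q. z $ Inl t + (\<Sum>s\<in>disjoint_edges q. z $ Inr (cell ({t} \<times> s))) = 0"
    using orthogonal_angle_sums_iff[of z] by simp_all
  define Z where "Z a b = z $ Inr (cell {a, b})" for a b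
  have Z_sym: "Z a b = Z b a" for a b by (simp add: Z_def insert_commute)
  have pair: "{t} \<times> {i, j} = {(t, i), (t, j)}" for t :: 't and i j :: 4 by auto
  have opposite: "Z (t, 0) (t, 1) + Z (t, 2) (t, 3) = - z $ Inl t"
    "Z (t, 0) (t, 2) + Z (t, 1) (t, 3) = - z $ Inl t"
    "Z (t, 0) (t, 3) + Z (t, 1) (t, 2) = - z $ Inl t" for t
  proof -
    have "{0, 1} \<noteq> {2, 3 :: 4}" "{0, 2} \<noteq> {1, 3 :: 4}" "{0, 3} \<noteq> {1, 2 :: 4}"
      by (simp_all add: doubleton_eq_iff)
    then show "Z (t, 0) (t, 1) + Z (t, 2) (t, 3) = - z $ Inl t"
      "Z (t, 0) (t, 2) + Z (t, 1) (t, 3) = - z $ Inl t"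
      "Z (t, 0) (t, 3) + Z (t, 1) (t, 2) = - z $ Inl t"
      using rel[of t Q01_23] rel[of t Q02_13] rel[of t Q03_12]
      unfolding disjoint_edges.simps pair Z_def by (simp_all add: pair)
  qed
  have "\<exists>w. \<forall>i j. i \<noteq> j \<longrightarrow> Z (t, i) (t, j) = w i + w j" for t
  proof (rule edge_weights_from_vertices[of "\<lambda>i j. Z (t, i) (t, j)", OF Z_sym opposite])
    fix w assume "\<And>i j. i \<noteq> j \<Longrightarrow> Z (t, i) (t, j) = w i + w j"
    then show "\<exists>w. \<forall>i j. i \<noteq> j \<longrightarrow> Z (t, i) (t, j) = w i + w j"
      by (intro exI[of _ w] allI impI)
  qed
  then have "\<exists>w. \<forall>t i j. i \<noteq> j \<longrightarrow> Z (t, i) (t, j) = w t i + w t j" by (intro choice allI)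
  then obtain w where w: "\<And>t i j. i \<noteq> j \<Longrightarrow> Z (t, i) (t, j) = w t i + w t j" by blast
  define u where "u c = w (fst c) (snd c)" for c :: "'t vertex"
  have u: "Z a b = u a + u b" if "fst a = fst b" "a \<noteq> b" for a b
    using w[of "snd a" "snd b" "fst a"] that by (cases a; cases b) (simp add: u_def)
  have u_glue: "u (\<phi> f a) = u a" if f: "f \<in> simplices 2" "a \<in> f" for f a
  proof -
    have "card (f - {a}) = 2" using f card_triangle[OF f(1)] by simp
    then obtain b c where bc: "f - {a} = {b, c}" "b \<noteq> c" by (auto simp: card_2_iff)
    then have abc: "b \<in> f" "c \<in> f" "a \<noteq> b" "a \<noteq> c" by blast+
    have Z_glue: "Z (\<phi> f x) (\<phi> f y) = Z x y" if "x \<in> f" "y \<in> f" for x y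
      using cell_edge[OF f(1) that] by (simp add: Z_def)
    \<comment> \<open>The gluing preserves the pairwise sums of \<open>u\<close> on the triangle, hence also its three values.\<close>
    have uu: "u (\<phi> f x) + u (\<phi> f y) = u x + u y" if xy: "x \<in> f" "y \<in> f" "x \<noteq> y" for x y
    proof -
      have "\<phi> f x \<noteq> \<phi> f y" using inj_on_face[OF f(1)] xy by (meson inj_onD)
      moreover have "fst (\<phi> f x) = fst (\<phi> f y)"
        by (rule triangle_vertices_in_tet[OF partner[OF f(1)]]) (use xy in simp_all)
      moreover have "fst x = fst y" by (rule triangle_vertices_in_tet[OF f(1) xy(1,2)])
      ultimately show ?thesis
        using u[of x y] u[of "\<phi> f x" "\<phi> f y"] Z_glue[OF xy(1,2)] xy(3) by simp
    qed
    show ?thesis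
      using uu[OF f(2) abc(1,3)] uu[OF f(2) abc(2,4)] uu[OF abc(1,2) bc(2)] by linarith
  qed
  obtain W where W: "\<And>a. W (cell {a}) = u a" "\<And>v. v \<notin> cells \<phi> 0 \<Longrightarrow> W v = 0"
    by (rule vertex_function[of u, OF u_glue]) (assumption, assumption, rule that)
  have "z = vertex_relation (\<chi> v. W v)"
  proof (subst vec_eq_iff, intro allI)
    fix i
    show "z $ i = vertex_relation (\<chi> v. W v) $ i"
    proof (cases i)
      case (Inl t)
      have "vertex_relation (\<chi> v. W v) $ Inl t = - (\<Sum>c\<in>tet t. u c)"
        by (simp add: vertex_relation_def W)
      also have "\<dots> = - (u (t, 0) + u (t, 1) + u (t, 2) + u (t, 3))"
        unfolding sum_tet UNIV_4_from_0 by simp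
      also have "\<dots> = z $ Inl t"
        using opposite(1)[of t] u[of "(t, 0)" "(t, 1)"] u[of "(t, 2)" "(t, 3)"] by simp
      finally show ?thesis using Inl by simp
    next
      case (Inr e)
      show ?thesis
      proof (cases "e \<in> cells \<phi> 1")
        case True
        then obtain a b where ab: "fst a = fst b" "a \<noteq> b" "e = cell {a, b}"
          unfolding cells_eq simplices_1 by blast
        then show ?thesis using Inr vertex_relation_edge[OF ab(1,2)] u[OF ab(1,2)] W by (simp add: Z_def)
      next
        case False
        then show ?thesis using Inr z by (simp add: supported_def vertex_relation_def)
      qed
    qed
  qed
  then show "z \<in> vertex_relation ` {u. \<forall>v. v \<notin> cells \<phi> 0 \<longrightarrow> u $ v = 0}"
    using W(2) by (intro image_eqI[of _ _ "\<chi> v. W v"]) simp_all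
next
  fix z assume "z \<in> vertex_relation ` {u. \<forall>v. v \<notin> cells \<phi> 0 \<longrightarrow> u $ v = 0}"
  then obtain u where "z = vertex_relation u" by blast
  then show "z \<in> {z \<in> supported. \<forall>\<theta>. angle_sums \<theta> \<bullet> z = 0}"
    by (simp add: vertex_relation_supported vertex_relation_orthogonal)
qed

lemma inj_on_vertex_relation: "inj_on vertex_relation {u. \<forall>v. v \<notin> cells \<phi> 0 \<longrightarrow> u $ v = 0}"
proof (rule inj_onI)
  fix x y
  assume x: "x \<in> {u. \<forall>v. v \<notin> cells \<phi> 0 \<longrightarrow> u $ v = 0}" and y: "y \<in> {u. \<forall>v. v \<notin> cells \<phi> 0 \<longrightarrow> u $ v = 0}"
    and eq: "vertex_relation x = vertex_relation y"
  have "x $ cell {a} = y $ cell {a}" for a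
  proof -
    obtain b where b: "fst b = fst a" "b \<noteq> a" by (rule third_vertex[of a a])
    obtain c where c: "fst c = fst a" "c \<noteq> a" "c \<noteq> b" by (rule third_vertex[of a b])
    have *: "x $ cell {p} + x $ cell {q} = y $ cell {p} + y $ cell {q}" if "fst p = fst q" "p \<noteq> q" for p q
      using vertex_relation_edge[OF that, of x] vertex_relation_edge[OF that, of y] eq by simp
    show ?thesis using *[of a b] *[of a c] *[of b c] b c by simp
  qed
  then have "x $ v = y $ v" if "v \<in> cells \<phi> 0" for v
    using that unfolding cells_eq simplices_0 by blast
  then have "x $ v = y $ v" for v using x y by (cases "v \<in> cells \<phi> 0") auto
  then show "x = y" by (simp add: vec_eq_iff)
qed

lemma dim_range_angle_sums: "dim (range angle_sums) + card (cells \<phi> 0) = CARD('t) + card (cells \<phi> 1)"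
proof -
  have "subspace (range angle_sums)"
    using linear_angle_sums subspace_UNIV by (rule linear_subspace_image)
  moreover have "range angle_sums \<subseteq> supported"
    by (auto simp: angle_sums_def supported_def)
  ultimately have "dim {z \<in> supported. \<forall>x \<in> range angle_sums. orthogonal x z} + dim (range angle_sums) = dim supported"
    by (intro dim_subspace_orthogonal_to_vectors subspace_supported)
  moreover have "{z \<in> supported. \<forall>x \<in> range angle_sums. orthogonal x z} = {z \<in> supported. \<forall>\<theta>. angle_sums \<theta> \<bullet> z = 0}"
    by (auto simp: orthogonal_def)
  moreover have "dim (vertex_relation ` {u. \<forall>v. v \<notin> cells \<phi> 0 \<longrightarrow> u $ v = 0}) = card (cells \<phi> 0)"
  proof -
    have "subspace {u :: real ^ ('t vertex set set). \<forall>v. v \<notin> cells \<phi> 0 \<longrightarrow> u $ v = 0}"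
      by (auto simp: subspace_def)
    then have span: "span {u :: real ^ ('t vertex set set). \<forall>v. v \<notin> cells \<phi> 0 \<longrightarrow> u $ v = 0}
        = {u. \<forall>v. v \<notin> cells \<phi> 0 \<longrightarrow> u $ v = 0}"
      by (simp only: span_eq_iff)
    then have "dim (vertex_relation ` {u. \<forall>v. v \<notin> cells \<phi> 0 \<longrightarrow> u $ v = 0})
        = dim {u :: real ^ ('t vertex set set). \<forall>v. v \<notin> cells \<phi> 0 \<longrightarrow> u $ v = 0}"
      by (intro dim_image_eq[OF linear_vertex_relation]) (simp only: span inj_on_vertex_relation)
    then show ?thesis by (simp only: dim_supported)
  qed
  ultimately show ?thesis by (simp add: angle_relations dim_supported_cells)
qed

lemma dim_kernel_angle_sums:
  "dim {\<theta>. angle_sums \<theta> = 0} + card (cells \<phi> 1) = 2 * CARD('t) + card (cells \<phi> 0)"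
proof -
  have "CARD(quad) = 3" unfolding UNIV_quad by simp
  then have "dim {\<theta>. angle_sums \<theta> = 0} + dim (range angle_sums) = CARD('t) * 3"
    using dim_kernel_plus_range[OF linear_angle_sums] by simp
  then show ?thesis using dim_range_angle_sums by linarith
qed

text \<open>The Fredholm alternative for \<open>angle_sums\<close>.\<close>

lemma angle_sums_solvable:
  assumes y: "y \<in> supported"
    and orth: "\<And>v. v \<in> cells \<phi> 0 \<Longrightarrow> vertex_relation (axis v 1) \<bullet> y = 0"
  obtains \<theta> where "angle_sums \<theta> = y"
proof -
  have sub: "subspace (range angle_sums)"
    using linear_angle_sums subspace_UNIV by (rule linear_subspace_image)
  obtain s n where sn: "s \<in> span (range angle_sums)" "y = s + n"
    and n: "\<And>w. w \<in> span (range angle_sums) \<Longrightarrow> orthogonal n w"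
    using orthogonal_subspace_decomp_exists[of "range angle_sums" y] by metis
  have "s \<in> range angle_sums" using sn(1) sub by (simp only: span_eq_iff[THEN iffD2])
  then obtain \<theta> where \<theta>: "s = angle_sums \<theta>" by blast
  have "n = y - s" using sn(2) by simp
  moreover have "s \<in> supported" by (simp add: \<theta> angle_sums_def supported_def)
  ultimately have "n \<in> supported" using y subspace_diff[OF subspace_supported] by blast
  moreover have "angle_sums \<theta> \<bullet> n = 0" for \<theta>
    using n[OF span_base, of "angle_sums \<theta>"] by (simp add: orthogonal_def inner_commute)
  ultimately have "n \<in> vertex_relation ` {u. \<forall>v. v \<notin> cells \<phi> 0 \<longrightarrow> u $ v = 0}"
    unfolding angle_relations[symmetric] by blast
  then obtain u where u: "n = vertex_relation u" "\<And>v. v \<notin> cells \<phi> 0 \<Longrightarrow> u $ v = 0" by blast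
  have "u = (\<Sum>v\<in>UNIV. u $ v *\<^sub>R axis v 1)"
    using basis_expansion[of u] unfolding scalar_mult_eq_scaleR by (rule sym)
  then have "vertex_relation u = vertex_relation (\<Sum>v\<in>UNIV. u $ v *\<^sub>R axis v 1)" by simp
  also have "\<dots> = (\<Sum>v\<in>UNIV. vertex_relation (u $ v *\<^sub>R axis v 1))"
    by (rule linear_sum[OF linear_vertex_relation])
  also have "\<dots> = (\<Sum>v\<in>UNIV. u $ v *\<^sub>R vertex_relation (axis v 1))"
    by (intro sum.cong refl linear_scale linear_vertex_relation)
  finally have "vertex_relation u = (\<Sum>v\<in>UNIV. u $ v *\<^sub>R vertex_relation (axis v 1))" .
  then have "n \<bullet> y = (\<Sum>v\<in>UNIV. u $ v * (vertex_relation (axis v 1) \<bullet> y))"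
    using u(1) by (simp add: inner_sum_left)
  also have "\<dots> = 0"
    by (rule sum.neutral) (use u(2) orth in force)
  finally have "n \<bullet> n = 0"
    using sn(2) \<theta> \<open>\<And>\<theta>. angle_sums \<theta> \<bullet> n = 0\<close> by (simp add: inner_add_right inner_commute)
  then have "angle_sums \<theta> = y" using sn(2) \<theta> by simp
  then show ?thesis using that by blast
qed

end

section \<open>The vertex links\<close>

instance bit :: finite
proof
  have "(UNIV :: bit set) \<subseteq> {0, 1}" using bit_not_zero_iff by blast
  then show "finite (UNIV :: bit set)" by (rule finite_subset) simp
qed

lemma card_supported_functions:
  fixes S :: "'n::finite set"
  shows "card {h :: bit^'n. \<forall>x. x \<notin> S \<longrightarrow> h $ x = 0} = 2 ^ card S"
proof -
  have "equiv S (Id_on S)" by (auto simp: equiv_def refl_on_def sym_def trans_def)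
  moreover have "S // Id_on S = (\<lambda>x. {x}) ` S" by (auto simp: quotient_def)
  moreover have "(\<forall>(x, y)\<in>Id_on S. h $ x = h $ y)" for h :: "bit^'n" by auto
  ultimately show ?thesis
    using card_class_functions[of S "Id_on S"] by (simp add: card_image inj_on_def)
qed

lemma class_functions_diff:
  fixes h h' :: "'a::group_add ^ 'n"
  assumes "h \<in> {h. (\<forall>x. x \<notin> S \<longrightarrow> h $ x = 0) \<and> (\<forall>(x, y)\<in>R. h $ x = h $ y)}"
    and "h' \<in> {h. (\<forall>x. x \<notin> S \<longrightarrow> h $ x = 0) \<and> (\<forall>(x, y)\<in>R. h $ x = h $ y)}"
  shows "h - h' \<in> {h. (\<forall>x. x \<notin> S \<longrightarrow> h $ x = 0) \<and> (\<forall>(x, y)\<in>R. h $ x = h $ y)}"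
proof (intro CollectI conjI allI impI ballI, goal_cases)
  case (1 x)
  then show ?case using assms by simp
next
  case (2 p)
  obtain x y where p: "p = (x, y)" by (cases p)
  then have "h $ x = h $ y" "h' $ x = h' $ y" using assms 2 by blast+
  then show ?case using p by simp
qed

lemma bit_add_eq_0_iff: "x + y = 0 \<longleftrightarrow> x = y" for x y :: bit
  by (cases x; cases y) simp_all

lemma bit_vec_diff: "x - y = x + y" for x y :: "bit^'n"
proof (subst vec_eq_iff, rule allI)
  fix i show "(x - y) $ i = (x + y) $ i" by (cases "x $ i"; cases "y $ i") simp_all
qed

text \<open>
  The link of the vertices is the surface whose triangles are the corners of \<open>X\<close>: the triangle at the
  corner \<open>c\<close> has an edge for each triangle \<open>f\<close> of \<open>X\<close> with \<open>c \<in> f\<close>, and a vertex for each edge from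
  \<open>c\<close> to another vertex \<open>b\<close>. So the edges of the link are the flags \<open>(f, c)\<close> up to gluing, and its
  vertices are the directed edges \<open>(c, b)\<close> up to gluing.
\<close>

definition directed_edges :: "('t vertex \<times> 't vertex) set" where
  "directed_edges = {(a, b). fst a = fst b \<and> a \<noteq> b}"

definition flags :: "('t vertex set \<times> 't vertex) set" where
  "flags = {(f, a). f \<in> simplices 2 \<and> a \<in> f}"

context paired_faces
begin

definition directed_glued :: "(('t vertex \<times> 't vertex) \<times> ('t vertex \<times> 't vertex)) set" where
  "directed_glued = {((a, b), (\<phi> f a, \<phi> f b)) | f a b. f \<in> simplices 2 \<and> a \<in> f \<and> b \<in> f}"

text \<open>The flag that a given flag is glued to.\<close>

definition flag_partner :: "'t vertex set \<times> 't vertex \<Rightarrow> 't vertex set \<times> 't vertex" where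
  "flag_partner p = (\<phi> (fst p) ` fst p, \<phi> (fst p) (snd p))"

text \<open>
  The cochains of the link over the field with two elements, in degrees 0 and 1, as functions
  invariant under gluing; the 2-cochains are all functions on the corners.
\<close>

definition link_cochains_0 :: "(bit ^ ('t vertex \<times> 't vertex)) set" where
  "link_cochains_0 = {h. (\<forall>x. x \<notin> directed_edges \<longrightarrow> h $ x = 0) \<and>
     (\<forall>(x, y) \<in> directed_glued\<^sup>* \<inter> directed_edges \<times> directed_edges. h $ x = h $ y)}"

definition link_cochains_1 :: "(bit ^ ('t vertex set \<times> 't vertex)) set" where
  "link_cochains_1 = {g. (\<forall>x. x \<notin> flags \<longrightarrow> g $ x = 0) \<and>
     (\<forall>(x, y) \<in> {(x, y). x \<in> flags \<and> (y = x \<or> y = flag_partner x)}. g $ x = g $ y)}"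

text \<open>The coboundary maps. For a flag \<open>(f, c)\<close> the set \<open>f - {c}\<close> consists of two vertices.\<close>

definition link_d0 :: "bit ^ ('t vertex \<times> 't vertex) \<Rightarrow> bit ^ ('t vertex set \<times> 't vertex)" where
  "link_d0 h = (\<chi> p. if p \<in> flags then \<Sum>b\<in>fst p - {snd p}. h $ (snd p, b) else 0)"

definition link_d1 :: "bit ^ ('t vertex set \<times> 't vertex) \<Rightarrow> bit ^ 't vertex" where
  "link_d1 g = (\<chi> c. \<Sum>f\<in>{f \<in> simplices 2. c \<in> f}. g $ (f, c))"

lemma sym_directed_glued: "sym directed_glued"
proof (rule symI)
  fix x y assume "(x, y) \<in> directed_glued"
  then obtain f a b where f: "f \<in> simplices 2" "a \<in> f" "b \<in> f" "x = (a, b)" "y = (\<phi> f a, \<phi> f b)"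
    unfolding directed_glued_def by blast
  then have "x = (\<phi> (\<phi> f ` f) (\<phi> f a), \<phi> (\<phi> f ` f) (\<phi> f b))"
    using partner_inverse[OF f(1)] by simp
  then show "(y, x) \<in> directed_glued"
    using f partner[OF f(1)] unfolding directed_glued_def by blast
qed

text \<open>
  Each edge of the triangulation has two ends, giving two different vertices of the link: a gluing
  that exchanged them would fold the edge.
\<close>

lemma card_link_cochains_0:
  assumes unfolded: "unfolded_edges \<phi>"
  shows "2 ^ (2 * card (cells \<phi> 1)) \<le> card link_cochains_0"
proof -
  define R where "R = directed_glued\<^sup>* \<inter> directed_edges \<times> directed_edges"
  have sym: "sym (directed_glued\<^sup>*)" by (rule sym_rtrancl[OF sym_directed_glued])
  have R: "equiv directed_edges R"
  proof (rule equivI)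
    show "R \<subseteq> directed_edges \<times> directed_edges" unfolding R_def by blast
    show "refl_on directed_edges R" unfolding R_def refl_on_def by blast
    show "sym R" using sym unfolding R_def sym_def by blast
    show "trans R" using trans_rtrancl[of directed_glued] unfolding R_def trans_def by blast
  qed
  have cell_R: "cell {fst p, snd p} = cell {fst q, snd q}" if "(p, q) \<in> directed_glued\<^sup>*" for p q
    using that
  proof induction
    case (step y z)
    then obtain f a b where f: "f \<in> simplices 2" "a \<in> f" "b \<in> f" "y = (a, b)" "z = (\<phi> f a, \<phi> f b)"
      unfolding directed_glued_def by blast
    then show ?case using step.IH cell_edge[OF f(1-3)] by simp
  qed (rule refl)
  have "\<forall>e\<in>cells \<phi> 1. \<exists>p. p \<in> directed_edges \<and> e = cell {fst p, snd p}"
  proof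
    fix e assume "e \<in> cells \<phi> 1"
    then obtain a b where "fst a = fst b" "a \<noteq> b" "e = cell {a, b}"
      unfolding cells_eq simplices_1 by blast
    then show "\<exists>p. p \<in> directed_edges \<and> e = cell {fst p, snd p}"
      by (intro exI[of _ "(a, b)"]) (simp add: directed_edges_def)
  qed
  then have "\<exists>r. \<forall>e\<in>cells \<phi> 1. r e \<in> directed_edges \<and> e = cell {fst (r e), snd (r e)}"
    by (rule bchoice)
  then obtain r where r: "\<And>e. e \<in> cells \<phi> 1 \<Longrightarrow> r e \<in> directed_edges \<and> e = cell {fst (r e), snd (r e)}"
    by blast
  define F where "F = (\<lambda>(e, d). R `` {if d then r e else prod.swap (r e)})"
  have swap: "prod.swap p \<in> directed_edges" if "p \<in> directed_edges" for p :: "'t vertex \<times> 't vertex"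
    using that unfolding directed_edges_def by auto
  have rep: "(if d then r e else prod.swap (r e)) \<in> directed_edges" if "e \<in> cells \<phi> 1" for e d
    using r[OF that] swap by simp
  have "inj_on F (cells \<phi> 1 \<times> UNIV)"
  proof (rule inj_onI)
    fix x y assume x: "x \<in> cells \<phi> 1 \<times> (UNIV :: bool set)" and y: "y \<in> cells \<phi> 1 \<times> (UNIV :: bool set)"
      and eq: "F x = F y"
    obtain e d e' d' where xy: "x = (e, d)" "y = (e', d')" by (cases x; cases y)
    have e: "e \<in> cells \<phi> 1" "e' \<in> cells \<phi> 1" using x y xy by simp_all
    let ?p = "if d then r e else prod.swap (r e)" and ?q = "if d' then r e' else prod.swap (r e')"
    have pq: "(?p, ?q) \<in> directed_glued\<^sup>*"
      using eq eq_equiv_class_iff[OF R rep[OF e(1)] rep[OF e(2)]] xy by (simp add: F_def R_def)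
    have rep_cell: "cell {fst (if d then r e else prod.swap (r e)), snd (if d then r e else prod.swap (r e))} = e"
      if "e \<in> cells \<phi> 1" for e d
    proof -
      have "{snd (r e), fst (r e)} = {fst (r e), snd (r e)}" by (rule insert_commute)
      then show ?thesis using r[OF that] by (cases d) simp_all
    qed
    have "cell {fst ?p, snd ?p} = e" "cell {fst ?q, snd ?q} = e'"
      by (rule rep_cell[OF e(1)], rule rep_cell[OF e(2)])
    then have ee: "e = e'" using cell_R[OF pq] by simp
    have no: "(r e, prod.swap (r e)) \<notin> directed_glued\<^sup>*"
    proof -
      obtain a b where ab: "r e = (a, b)" by (cases "r e")
      have "fst a = fst b \<and> a \<noteq> b"
        using r[OF e(1)] ab by (simp add: directed_edges_def)
      then have "{a, b} \<in> simplices 1" unfolding simplices_1 by blast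
      then have "((a, b), (b, a)) \<notin> directed_glued\<^sup>*"
        using unfolded unfolding unfolded_edges_def directed_glued_def by (elim allE impE)
      then show ?thesis using ab by simp
    qed
    have "d = d'"
    proof (rule ccontr)
      assume "d \<noteq> d'"
      then have "(r e, prod.swap (r e)) \<in> directed_glued\<^sup>* \<or> (prod.swap (r e), r e) \<in> directed_glued\<^sup>*"
        using pq ee by (cases d) simp_all
      then show False using no symD[OF sym] by blast
    qed
    then show "x = y" using xy ee by simp
  qed
  moreover have "F ` (cells \<phi> 1 \<times> UNIV) \<subseteq> directed_edges // R"
  proof (rule image_subsetI)
    fix x assume "x \<in> cells \<phi> 1 \<times> (UNIV :: bool set)"
    then obtain e d where "x = (e, d)" "e \<in> cells \<phi> 1" by blast
    then show "F x \<in> directed_edges // R" unfolding F_def using quotientI[OF rep] by simp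
  qed
  ultimately have "card (cells \<phi> 1 \<times> (UNIV :: bool set)) \<le> card (directed_edges // R)"
    by (rule card_inj_on_le) simp
  moreover have "card link_cochains_0 = 2 ^ card (directed_edges // R)"
    unfolding link_cochains_0_def R_def[symmetric] by (rule card_class_functions[OF R])
  ultimately show ?thesis by (simp add: card_cartesian_product mult.commute)
qed

lemma flag_partner: "p \<in> flags \<Longrightarrow> flag_partner p \<in> flags \<and> flag_partner p \<noteq> p \<and> flag_partner (flag_partner p) = p"
proof -
  assume "p \<in> flags"
  then obtain f a where f: "p = (f, a)" "f \<in> simplices 2" "a \<in> f" unfolding flags_def by blast
  then show ?thesis
    using partner[OF f(2)] partner_neq[OF f(2)] partner_partner[OF f(2)] partner_inverse[OF f(2,3)]
    by (simp add: flags_def flag_partner_def)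
qed

lemma card_flags: "card (flags :: ('t vertex set \<times> 't vertex) set) = 12 * CARD('t)"
proof -
  have "flags = (SIGMA f:(simplices 2 :: 't vertex set set). f)" by (auto simp: flags_def)
  then have "card (flags :: ('t vertex set \<times> 't vertex) set)
      = card (SIGMA f:(simplices 2 :: 't vertex set set). f)"
    by (rule arg_cong)
  also have "\<dots> = (\<Sum>f\<in>simplices 2. card (f :: 't vertex set))"
    by (rule card_SigmaI) simp_all
  also have "\<dots> = (\<Sum>f\<in>(simplices 2 :: 't vertex set set). 3)"
    by (rule sum.cong) (simp_all add: card_triangle)
  finally show ?thesis by (simp add: card_triangles)
qed

lemma card_link_cochains_1: "card link_cochains_1 = 2 ^ (6 * CARD('t))"
proof -
  define R where "R = {(x, y). x \<in> flags \<and> (y = x \<or> y = flag_partner x)}"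
  have "equiv flags R"
  proof (rule equivI)
    show "R \<subseteq> flags \<times> flags" using flag_partner unfolding R_def by blast
    show "refl_on flags R" unfolding R_def refl_on_def by blast
    show "sym R"
    proof (rule symI)
      fix x y assume "(x, y) \<in> R"
      then have "x \<in> flags" "y = x \<or> y = flag_partner x" unfolding R_def by blast+
      then show "(y, x) \<in> R" unfolding R_def using flag_partner[of x] by auto
    qed
    show "trans R"
    proof (rule transI)
      fix x y z assume "(x, y) \<in> R" "(y, z) \<in> R"
      then have "x \<in> flags" "y = x \<or> y = flag_partner x" "z = y \<or> z = flag_partner y"
        unfolding R_def by blast+
      then show "(x, z) \<in> R" unfolding R_def using flag_partner[of x] by auto
    qed
  qed
  then have "card link_cochains_1 = 2 ^ card (flags // R)"
    unfolding link_cochains_1_def R_def[symmetric] by (rule card_class_functions)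
  moreover have "flags // R = (\<lambda>p. {p, flag_partner p}) ` flags"
    unfolding quotient_def R_def by auto
  moreover have "2 * card ((\<lambda>p. {p, flag_partner p}) ` flags) = card (flags :: ('t vertex set \<times> 't vertex) set)"
    by (rule card_involution_orbits[of flags flag_partner]) (simp_all add: flag_partner)
  ultimately show ?thesis by (simp add: card_flags)
qed

lemma link_d0_in:
  assumes h: "h \<in> link_cochains_0"
  shows "link_d0 h \<in> link_cochains_1"
proof -
  have "link_d0 h $ p = link_d0 h $ flag_partner p" if p: "p \<in> flags" for p
  proof -
    obtain f a where fa: "p = (f, a)" "f \<in> simplices 2" "a \<in> f" using p unfolding flags_def by blast
    have inj: "inj_on (\<phi> f) (f - {a})" using inj_on_face[OF fa(2)] by (rule inj_on_diff)
    have img: "\<phi> f ` f - {\<phi> f a} = \<phi> f ` (f - {a})"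
      using inj_on_face[OF fa(2)] fa(3) by (auto simp: inj_on_def)
    have "link_d0 h $ flag_partner p = (\<Sum>b\<in>\<phi> f ` f - {\<phi> f a}. h $ (\<phi> f a, b))"
      using flag_partner[OF p] fa by (simp add: link_d0_def flag_partner_def)
    also have "\<dots> = (\<Sum>b\<in>f - {a}. h $ (\<phi> f a, \<phi> f b))"
      unfolding img using inj by (simp add: sum.reindex)
    also have "\<dots> = (\<Sum>b\<in>f - {a}. h $ (a, b))"
    proof (rule sum.cong[OF refl])
      fix b assume b: "b \<in> f - {a}"
      have "((a, b), (\<phi> f a, \<phi> f b)) \<in> directed_glued"
        unfolding directed_glued_def using b fa by blast
      moreover have "(a, b) \<in> directed_edges"
        using b fa triangle_vertices_in_tet[OF fa(2,3)] unfolding directed_edges_def by blast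
      moreover have "(\<phi> f a, \<phi> f b) \<in> directed_edges"
      proof -
        have "\<phi> f a \<noteq> \<phi> f b" using inj_on_face[OF fa(2)] b fa(3) by (auto simp: inj_on_def)
        moreover have "fst (\<phi> f a) = fst (\<phi> f b)"
          by (rule triangle_vertices_in_tet[OF partner[OF fa(2)]]) (use b fa(3) in simp_all)
        ultimately show ?thesis unfolding directed_edges_def by blast
      qed
      ultimately have "((a, b), (\<phi> f a, \<phi> f b)) \<in> directed_glued\<^sup>* \<inter> directed_edges \<times> directed_edges"
        by blast
      then have "h $ (a, b) = h $ (\<phi> f a, \<phi> f b)" using h unfolding link_cochains_0_def by blast
      then show "h $ (\<phi> f a, \<phi> f b) = h $ (a, b)" by (rule sym)
    qed
    also have "\<dots> = link_d0 h $ p" using p fa(1) by (simp add: link_d0_def)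
    finally show ?thesis by (rule sym)
  qed
  then have "link_d0 h $ x = link_d0 h $ y" if "x \<in> flags \<and> (y = x \<or> y = flag_partner x)" for x y
    using that by blast
  moreover have "link_d0 h $ x = 0" if "x \<notin> flags" for x using that by (simp add: link_d0_def)
  ultimately show ?thesis unfolding link_cochains_1_def by blast
qed

lemma link_d1_d0:
  assumes h: "h \<in> link_cochains_0"
  shows "link_d1 (link_d0 h) = 0"
proof -
  have "link_d1 (link_d0 h) $ c = 0" for c
  proof -
    have "link_d1 (link_d0 h) $ c = (\<Sum>f\<in>{f \<in> simplices 2. c \<in> f}. \<Sum>b\<in>f - {c}. h $ (c, b))"
      unfolding link_d1_def link_d0_def by (simp add: flags_def)
    also have "\<dots> = (\<Sum>f\<in>{f \<in> simplices 2. c \<in> f}. \<Sum>b\<in>tet (fst c) - {c}. if b \<in> f then h $ (c, b) else 0)"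
    proof (rule sum.cong[OF refl])
      fix f assume f: "f \<in> {f \<in> simplices 2. c \<in> f}"
      have "f - {c} = {b \<in> tet (fst c) - {c}. b \<in> f}"
      proof -
        have "b \<in> tet (fst c)" if "b \<in> f" for b
          using f that triangle_vertices_in_tet[of f b c] by simp
        then show ?thesis by blast
      qed
      show "(\<Sum>b\<in>f - {c}. h $ (c, b)) = (\<Sum>b\<in>tet (fst c) - {c}. if b \<in> f then h $ (c, b) else 0)"
        unfolding \<open>f - {c} = _\<close> by (rule sum.inter_filter) (rule finite)
    qed
    also have "\<dots> = (\<Sum>b\<in>tet (fst c) - {c}. \<Sum>f\<in>{f \<in> simplices 2. c \<in> f}. if b \<in> f then h $ (c, b) else 0)"
      by (rule sum.swap)
    also have "\<dots> = (\<Sum>b\<in>tet (fst c) - {c}. 0)"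
    proof (rule sum.cong[OF refl])
      fix b assume b: "b \<in> tet (fst c) - {c}"
      have "(\<Sum>f\<in>{f \<in> simplices 2. c \<in> f}. if b \<in> f then h $ (c, b) else 0)
          = (\<Sum>f\<in>{f \<in> {f \<in> simplices 2. c \<in> f}. b \<in> f}. h $ (c, b))"
        by (rule sum.inter_filter[symmetric]) simp
      also have "{f \<in> {f \<in> simplices 2. c \<in> f}. b \<in> f} = {f \<in> simplices 2. c \<in> f \<and> b \<in> f}"
        by blast
      also have "(\<Sum>f\<in>{f \<in> simplices 2. c \<in> f \<and> b \<in> f}. h $ (c, b)) = 0"
      proof -
        have "card {f \<in> simplices 2. c \<in> f \<and> b \<in> f} = 2"
          by (rule triangles_at_edge) (use b in auto)
        then show ?thesis by simp
      qed
      finally show "(\<Sum>f\<in>{f \<in> simplices 2. c \<in> f}. if b \<in> f then h $ (c, b) else 0) = 0" .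
    qed
    finally show ?thesis by simp
  qed
  then show ?thesis by (simp add: vec_eq_iff)
qed

text \<open>A 0-cocycle is constant on the link of each vertex, as any two vertices of a link triangle are adjacent.\<close>

lemma card_link_d0_kernel: "card {h \<in> link_cochains_0. link_d0 h = 0} \<le> 2 ^ card (cells \<phi> 0)"
proof -
  define RV where "RV = {(a, b). cell {a} = cell {b}}"
  define W where "W = {w :: bit ^ 't vertex. (\<forall>x. x \<notin> UNIV \<longrightarrow> w $ x = 0) \<and> (\<forall>(x, y)\<in>RV. w $ x = w $ y)}"
  define ext :: "bit ^ 't vertex \<Rightarrow> bit ^ ('t vertex \<times> 't vertex)"
    where "ext w = (\<chi> p. if p \<in> directed_edges then w $ fst p else 0)" for w
  have "equiv UNIV RV"
    unfolding RV_def by (rule equivI) (auto simp: refl_on_def sym_def trans_def)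
  then have "card W = 2 ^ card (UNIV // RV)" unfolding W_def by (rule card_class_functions)
  moreover have "UNIV // RV \<subseteq> (\<lambda>v. {b. {b} \<in> v}) ` cells \<phi> 0"
  proof
    fix X assume "X \<in> UNIV // RV"
    then obtain a where "X = RV `` {a}" unfolding quotient_def by blast
    then have "X = {b. {b} \<in> cell {a}}" unfolding RV_def mem_cell by (auto simp: eq_commute)
    then show "X \<in> (\<lambda>v. {b. {b} \<in> v}) ` cells \<phi> 0" using vertex_in_cells by blast
  qed
  then have "card (UNIV // RV) \<le> card (cells \<phi> 0)"
    by (rule surj_card_le[OF finite])
  ultimately have W: "card W \<le> 2 ^ card (cells \<phi> 0)" by simp
  have "{h \<in> link_cochains_0. link_d0 h = 0} \<subseteq> ext ` W"
  proof
    fix h assume "h \<in> {h \<in> link_cochains_0. link_d0 h = 0}"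
    then have h: "h \<in> link_cochains_0" and d0: "link_d0 h = 0" by simp_all
    have eq: "h $ (a, b) = h $ (a, c)" if bc: "fst b = fst a" "fst c = fst a" "b \<noteq> a" "c \<noteq> a" for a b c
    proof (cases "b = c")
      case False
      define f where "f = {a, b, c}"
      have f: "f \<in> simplices 2" unfolding f_def by (rule triangle_through) (use bc False in auto)
      have fa: "f - {a} = {b, c}" using bc unfolding f_def by blast
      have "(f, a) \<in> flags" using f unfolding flags_def f_def by blast
      then have "link_d0 h $ (f, a) = h $ (a, b) + h $ (a, c)"
        using fa False by (simp add: link_d0_def)
      then have "h $ (a, b) + h $ (a, c) = 0" by (simp only: d0 zero_index)
      then show ?thesis by (rule bit_add_eq_0_iff[THEN iffD1])
    qed simp
    have "\<forall>a :: 't vertex. \<exists>b. fst b = fst a \<and> b \<noteq> a"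
    proof
      fix a :: "'t vertex"
      show "\<exists>b. fst b = fst a \<and> b \<noteq> a" by (rule third_vertex[of a a]) (intro exI conjI)
    qed
    then obtain n where n: "\<And>a. fst (n a) = fst a \<and> n a \<noteq> (a :: 't vertex)"
      using choice[of "\<lambda>a b. fst b = fst a \<and> b \<noteq> a"] by blast
    define w where "w a = h $ (a, n a)" for a
    have w: "h $ (a, b) = w a" if "fst b = fst a" "b \<noteq> a" for a b
      unfolding w_def by (rule eq) (use that n in simp_all)
    have "w (\<phi> f a) = w a" if f: "f \<in> simplices 2" "a \<in> f" for f a
    proof -
      have "card (f - {a}) = 2" using f card_triangle[OF f(1)] by simp
      then have "f - {a} \<noteq> {}" by (metis card.empty zero_neq_numeral)
      then obtain b where b: "b \<in> f" "b \<noteq> a" by blast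
      have "((a, b), (\<phi> f a, \<phi> f b)) \<in> directed_glued"
        unfolding directed_glued_def using b f by blast
      moreover have ab: "fst b = fst a" by (rule triangle_vertices_in_tet[OF f(1) b(1) f(2)])
      moreover have "\<phi> f b \<noteq> \<phi> f a" using inj_on_face[OF f(1)] b f(2) by (auto simp: inj_on_def)
      moreover have "fst (\<phi> f b) = fst (\<phi> f a)"
        by (rule triangle_vertices_in_tet[OF partner[OF f(1)]]) (use b f(2) in simp_all)
      ultimately have glued: "((a, b), (\<phi> f a, \<phi> f b)) \<in> directed_glued\<^sup>* \<inter> directed_edges \<times> directed_edges"
        and "fst (\<phi> f b) = fst (\<phi> f a)" "\<phi> f b \<noteq> \<phi> f a"
        using b(2) by (auto simp: directed_edges_def)
      have "h $ (a, b) = h $ (\<phi> f a, \<phi> f b)"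
        using glued h unfolding link_cochains_0_def by blast
      then show ?thesis
        using w[OF ab b(2)] w[OF \<open>fst (\<phi> f b) = fst (\<phi> f a)\<close> \<open>\<phi> f b \<noteq> \<phi> f a\<close>] by simp
    qed
    then have w_cell: "w a = w b" if "cell {a} = cell {b}" for a b
      using constant_on_vertex_cells[of w, OF _ that] by blast
    have "h = ext (\<chi> a. w a)"
    proof (subst vec_eq_iff, rule allI)
      fix p
      show "h $ p = ext (\<chi> a. w a) $ p"
      proof (cases "p \<in> directed_edges")
        case True
        then have "fst (snd p) = fst (fst p)" "snd p \<noteq> fst p" by (auto simp: directed_edges_def)
        from w[OF this] show ?thesis using True by (simp add: ext_def)
      next
        case False
        moreover from this have "h $ p = 0" using h unfolding link_cochains_0_def by blast
        ultimately show ?thesis by (simp add: ext_def)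
      qed
    qed
    moreover have "(\<chi> a. w a) \<in> W"
    proof -
      have "\<forall>(x, y)\<in>RV. w x = w y"
      proof
        fix p assume "p \<in> RV"
        then obtain x y where "p = (x, y)" "cell {x} = cell {y}" unfolding RV_def by blast
        then show "case p of (x, y) \<Rightarrow> w x = w y" using w_cell[of x y] by simp
      qed
      then show ?thesis unfolding W_def by simp
    qed
    ultimately show "h \<in> ext ` W" by (rule image_eqI)
  qed
  then have "card {h \<in> link_cochains_0. link_d0 h = 0} \<le> card W"
    by (rule surj_card_le[OF finite])
  then show ?thesis using W by (rule order_trans)
qed

lemma link_cochains_diff:
  "x \<in> link_cochains_0 \<Longrightarrow> y \<in> link_cochains_0 \<Longrightarrow> x - y \<in> link_cochains_0"
  "x' \<in> link_cochains_1 \<Longrightarrow> y' \<in> link_cochains_1 \<Longrightarrow> x' - y' \<in> link_cochains_1"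
  unfolding link_cochains_0_def link_cochains_1_def by (rule class_functions_diff; assumption)+

lemma link_d0_diff: "link_d0 (x - y) = link_d0 x - link_d0 y"
proof (subst vec_eq_iff, rule allI)
  fix p show "link_d0 (x - y) $ p = (link_d0 x - link_d0 y) $ p"
    by (cases "p \<in> flags")
      (simp_all only: link_d0_def vec_lambda_beta vector_minus_component sum_subtractf if_True if_False diff_self)
qed

lemma link_d1_diff: "link_d1 (x - y) = link_d1 x - link_d1 y"
proof (subst vec_eq_iff, rule allI)
  fix p show "link_d1 (x - y) $ p = (link_d1 x - link_d1 y) $ p"
    by (simp only: link_d1_def vec_lambda_beta vector_minus_component sum_subtractf)
qed

text \<open>
  Modulo coboundaries, the indicator functions of adjacent corners agree, hence so do those of all
  corners at one vertex. So every 2-cochain is cohomologous to one that is supported on a set of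
  representatives \<open>r\<close> of the vertices.
\<close>

lemma card_link_d1_image: "2 ^ (4 * CARD('t)) \<le> card (link_d1 ` link_cochains_1) * 2 ^ card (cells \<phi> 0)"
proof -
  let ?I = "link_d1 ` link_cochains_1"
  let ?\<delta> = "\<lambda>c. axis c 1 :: bit ^ 't vertex"
  have I0: "0 \<in> ?I"
  proof -
    have "0 \<in> link_cochains_1" by (auto simp: link_cochains_1_def)
    moreover have "link_d1 0 = 0" by (simp add: vec_eq_iff link_d1_def)
    ultimately show ?thesis by (metis image_eqI)
  qed
  have Iadd: "x + y \<in> ?I" if xy: "x \<in> ?I" "y \<in> ?I" for x y
  proof -
    obtain g where g: "g \<in> link_cochains_1" "x = link_d1 g" using xy(1) by blast
    obtain h where h: "h \<in> link_cochains_1" "y = link_d1 h" using xy(2) by blast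
    have "x - y = link_d1 (g - h)" "g - h \<in> link_cochains_1"
      using g h link_cochains_diff(2)[of g h] link_d1_diff[of g h] by simp_all
    then show ?thesis unfolding bit_vec_diff by blast
  qed
  have glue: "?\<delta> a + ?\<delta> (\<phi> f a) \<in> ?I" if f: "f \<in> simplices 2" "a \<in> f" for f a
  proof -
    define p where "p = (f, a)"
    have p: "p \<in> flags" using f by (simp add: p_def flags_def)
    define g :: "bit ^ ('t vertex set \<times> 't vertex)"
      where "g = (\<chi> x. of_bool (x = p) + of_bool (x = flag_partner p))"
    have "g \<in> link_cochains_1"
    proof -
      have "g $ flag_partner x = g $ x" if x: "x \<in> flags" for x
      proof -
        have "flag_partner x = flag_partner p \<longleftrightarrow> x = p" "flag_partner x = p \<longleftrightarrow> x = flag_partner p"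
          using flag_partner[OF x] flag_partner[OF p] by metis+
        then show ?thesis unfolding g_def vec_lambda_beta by (simp only: add.commute)
      qed
      then have "g $ x = g $ y" if "x \<in> flags \<and> (y = x \<or> y = flag_partner x)" for x y
        using that by metis
      moreover have "g $ x = 0" if "x \<notin> flags" for x
        using that p flag_partner[OF p] by (auto simp: g_def)
      ultimately show ?thesis unfolding link_cochains_1_def by blast
    qed
    moreover have "link_d1 g = ?\<delta> a + ?\<delta> (\<phi> f a)"
    proof (subst vec_eq_iff, rule allI)
      fix c
      have "(\<Sum>f'\<in>{f' \<in> simplices 2. c \<in> f'}. of_bool ((f', c) = q)) = (of_bool (c = snd q) :: bit)"
        if "q \<in> flags" for q :: "'t vertex set \<times> 't vertex"
      proof -
        have "(\<Sum>f'\<in>{f' \<in> simplices 2. c \<in> f'}. of_bool ((f', c) = q))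
            = (\<Sum>f'\<in>{f' \<in> simplices 2. c \<in> f'}. if f' = fst q then of_bool (c = snd q) else (0 :: bit))"
          by (rule sum.cong) (auto simp: prod_eq_iff)
        also have "\<dots> = of_bool (c = snd q)"
          using that by (auto simp: flags_def)
        finally show ?thesis .
      qed
      note one = this
      have "link_d1 g $ c = of_bool (c = snd p) + of_bool (c = snd (flag_partner p))"
        unfolding link_d1_def g_def vec_lambda_beta sum.distrib
        using one[OF p] one[of "flag_partner p"] flag_partner[OF p] by (simp only:)
      then show "link_d1 g $ c = (?\<delta> a + ?\<delta> (\<phi> f a)) $ c"
        by (simp add: p_def flag_partner_def axis_def of_bool_def)
    qed
    ultimately show ?thesis by (metis image_eqI)
  qed
  have same_cell: "?\<delta> a + ?\<delta> b \<in> ?I" if "cell {a} = cell {b}" for a b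
  proof -
    have "({a}, {b}) \<in> (glued \<phi>)\<^sup>*" using that by (simp only: cell_eq_iff)
    then have "\<exists>c. {b} = {c} \<and> ?\<delta> a + ?\<delta> c \<in> ?I"
    proof induction
      case base
      have "?\<delta> a + ?\<delta> a = 0" using bit_vec_diff[of "?\<delta> a" "?\<delta> a"] by simp
      then show ?case using I0 by simp
    next
      case (step s s')
      then obtain c f where c: "s = {c}" "?\<delta> a + ?\<delta> c \<in> ?I" and f: "f \<in> simplices 2" "c \<in> f" "s' = {\<phi> f c}"
        unfolding glued_def by auto
      have "(?\<delta> a + ?\<delta> c) + (?\<delta> c + ?\<delta> (\<phi> f c)) = ?\<delta> a + ?\<delta> (\<phi> f c)"
        using bit_vec_diff[of "?\<delta> c" "?\<delta> c"] by (simp add: add.assoc[symmetric])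
      then show ?case using Iadd[OF c(2) glue[OF f(1,2)]] f(3) by simp
    qed
    then show ?thesis by simp
  qed
  define r where "r v = (SOME a. {a} \<in> v)" for v :: "'t vertex set set"
  have r: "cell {a} = cell {r (cell {a})}" for a
  proof -
    have "{a} \<in> cell {a}" by (simp add: mem_cell)
    then have "{r (cell {a})} \<in> cell {a}" unfolding r_def by (rule someI)
    then show ?thesis by (simp add: mem_cell)
  qed
  \<comment> \<open>the 2-cochains supported on the representatives\<close>
  define S where "S = {s :: bit ^ 't vertex. \<forall>x. x \<notin> r ` cells \<phi> 0 \<longrightarrow> s $ x = 0}"
  have "card S = 2 ^ card (r ` cells \<phi> 0)" unfolding S_def by (rule card_supported_functions)
  also have "\<dots> \<le> 2 ^ card (cells \<phi> 0)" by (intro power_increasing card_image_le) simp_all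
  finally have S: "card S \<le> 2 ^ card (cells \<phi> 0)" .
  define Q where "Q x \<longleftrightarrow> (\<exists>i\<in>?I. \<exists>s\<in>S. x = i + s)" for x
  have "0 \<in> S" by (simp add: S_def)
  moreover have "0 = 0 + (0 :: bit ^ 't vertex)" by simp
  ultimately have Q0: "Q 0" unfolding Q_def using I0 by blast
  have Qadd: "Q (x + y)" if "Q x" "Q y" for x y
  proof -
    obtain i s j t where "i \<in> ?I" "j \<in> ?I" "s \<in> S" "t \<in> S" "x = i + s" "y = j + t"
      using \<open>Q x\<close> \<open>Q y\<close> unfolding Q_def by blast
    moreover have "(i + s) + (j + t) = (i + j) + (s + t)" by (simp add: algebra_simps)
    moreover have "s + t \<in> S" using \<open>s \<in> S\<close> \<open>t \<in> S\<close> by (simp add: S_def)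
    ultimately show ?thesis unfolding Q_def using Iadd[of i j] by metis
  qed
  have Qaxis: "Q (?\<delta> c)" for c
  proof -
    have "?\<delta> c = (?\<delta> c + ?\<delta> (r (cell {c}))) + ?\<delta> (r (cell {c}))"
      using bit_vec_diff[of "?\<delta> (r (cell {c}))" "?\<delta> (r (cell {c}))"] by (simp add: add.assoc)
    moreover have "?\<delta> (r (cell {c})) \<in> S" by (auto simp: S_def axis_def)
    ultimately show ?thesis unfolding Q_def using same_cell[OF r[of c]] by blast
  qed
  have "Q (\<Sum>c\<in>A. x $ c *s ?\<delta> c)" for x :: "bit ^ 't vertex" and A
  proof (induction A rule: infinite_finite_induct)
    case (insert c A)
    have "x $ c *s ?\<delta> c = 0 \<or> x $ c *s ?\<delta> c = ?\<delta> c" by (cases "x $ c") simp_all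
    then have "Q (x $ c *s ?\<delta> c)" using Q0 Qaxis by metis
    then show ?case using insert Qadd by simp
  qed (simp_all add: Q0)
  note Qsum = this
  have "Q x" for x using Qsum[of x UNIV] unfolding basis_expansion .
  have "UNIV \<subseteq> (\<lambda>(i, s). i + s) ` (?I \<times> S)"
  proof
    fix x :: "bit ^ 't vertex"
    obtain i s where "i \<in> ?I" "s \<in> S" "x = i + s" using \<open>Q x\<close> unfolding Q_def by blast
    then show "x \<in> (\<lambda>(i, s). i + s) ` (?I \<times> S)" by (intro image_eqI[of _ _ "(i, s)"]) simp_all
  qed
  then have "CARD(bit ^ 't vertex) \<le> card (?I \<times> S)" by (rule surj_card_le[OF finite])
  also have "\<dots> = card ?I * card S" by (rule card_cartesian_product)
  also have "\<dots> \<le> card ?I * 2 ^ card (cells \<phi> 0)" using S by simp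
  also have "CARD(bit ^ 't vertex) = 2 ^ (4 * CARD('t))"
    using card_supported_functions[of "UNIV :: 't vertex set"] by (simp add: mult.commute)
  finally show ?thesis .
qed

text \<open>
  This says that \<open>M\<close> has non-negative Euler characteristic. It follows by counting, as the image of
  \<open>link_d0\<close> is contained in the kernel of \<open>link_d1\<close>.
\<close>

lemma card_edges_le:
  assumes "unfolded_edges \<phi>"
  shows "card (cells \<phi> 1) \<le> card (cells \<phi> 0) + CARD('t)"
proof -
  let ?E = "card (cells \<phi> 1)" and ?V = "card (cells \<phi> 0)" and ?T = "CARD('t)"
  let ?K = "{g \<in> link_cochains_1. link_d1 g = 0}"
  have "2 ^ (2 * ?E) \<le> card link_cochains_0" using assms by (rule card_link_cochains_0)
  also have "\<dots> = card {h \<in> link_cochains_0. link_d0 h = 0} * card (link_d0 ` link_cochains_0)"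
    by (rule card_hom_kernel_image[OF finite]) (simp_all only: link_cochains_diff link_d0_diff)
  also have "\<dots> \<le> 2 ^ ?V * card ?K"
  proof (rule mult_le_mono[OF card_link_d0_kernel card_mono[OF finite]])
    show "link_d0 ` link_cochains_0 \<subseteq> ?K" using link_d0_in link_d1_d0 by blast
  qed
  finally have 1: "2 ^ (2 * ?E) \<le> 2 ^ ?V * card ?K" .
  have 2: "2 ^ (6 * ?T) = card ?K * card (link_d1 ` link_cochains_1)"
    unfolding card_link_cochains_1[symmetric]
    by (rule card_hom_kernel_image[OF finite]) (simp_all only: link_cochains_diff link_d1_diff)
  have "2 ^ (2 * ?E + 4 * ?T) \<le> (2 ^ ?V * card ?K) * (card (link_d1 ` link_cochains_1) * 2 ^ ?V)"
    unfolding power_add by (rule mult_le_mono[OF 1 card_link_d1_image])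
  also have "\<dots> = (2 :: nat) ^ (?V + 6 * ?T + ?V)"
    unfolding power_add 2 by (simp add: mult_ac)
  finally have "2 * ?E + 4 * ?T \<le> ?V + 6 * ?T + ?V" by simp
  then show ?thesis by linarith
qed

end

section \<open>Existence of angle structures\<close>

lemma prod_cis: "(\<Prod>x\<in>A. cis (f x)) = cis (\<Sum>x\<in>A. f x)"
  by (induction A rule: infinite_finite_induct) (simp_all add: cis_mult)

lemma cis_eq_1_iff: "cis x = 1 \<longleftrightarrow> (\<exists>n::int. x = 2 * pi * of_int n)"
  by (simp add: cis_conv_exp exp_eq_1 mult_ac)

lemma cis_2pi_eq_1E:
  assumes "cis (2 * pi * x) = 1"
  obtains n :: int where "x = of_int n"
proof -
  obtain n :: int where "2 * pi * x = 2 * pi * of_int n" using assms cis_eq_1_iff by blast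
  then have "x = of_int n" by simp
  then show ?thesis by (rule that)
qed

context paired_faces
begin

text \<open>
  The link of a vertex has an even number of triangles, as three times this number is twice the
  number of its edges.
\<close>

lemma even_card_link: "even (card {c. cell {c} = v})"
proof -
  define S where "S = {p \<in> flags. cell {snd p} = v}"
  have "S = (SIGMA c:{c. cell {c} = v}. {f \<in> simplices 2. c \<in> f})\<inverse>"
    unfolding S_def flags_def by auto
  then have "card S = card (SIGMA c:{c. cell {c} = v}. {f \<in> simplices 2. c \<in> f})"
    by (simp only: card_inverse)
  also have "\<dots> = (\<Sum>c\<in>{c. cell {c} = v}. card {f \<in> simplices 2. c \<in> f})"
    by (rule card_SigmaI) simp_all
  also have "\<dots> = 3 * card {c. cell {c} = v}"
    by (simp add: triangles_at_vertex)
  finally have "card S = 3 * card {c. cell {c} = v}" .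
  moreover have "2 * card ((\<lambda>p. {p, flag_partner p}) ` S) = card S"
  proof (rule card_involution_orbits[OF finite])
    fix p assume p: "p \<in> S"
    then obtain f a where f: "p = (f, a)" "f \<in> simplices 2" "a \<in> f" "cell {a} = v"
      unfolding S_def flags_def by auto
    then have "cell {snd (flag_partner p)} = v"
      using cell_vertex[OF f(2,3)] by (simp add: flag_partner_def)
    then show "flag_partner p \<in> S \<and> flag_partner p \<noteq> p \<and> flag_partner (flag_partner p) = p"
      using p flag_partner[of p] unfolding S_def by blast
  qed
  moreover have "even n" if "s = 3 * n" "2 * m = s" for s m n :: nat
    using that by presburger
  ultimately show ?thesis by blast
qed

text \<open>
  Membership in the lattice spanned by the edges, an edge standing for the sum of its two ends. Values
  of \<open>a\<close> outside the set of vertices are ignored.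
\<close>

definition edge_lattice :: "('t vertex set set \<Rightarrow> int) \<Rightarrow> bool" where
  "edge_lattice a \<longleftrightarrow> (\<exists>m. \<forall>v\<in>cells \<phi> 0. a v = (\<Sum>e\<in>cells \<phi> 1. int (ends e v) * m e))"

lemma edge_lattice_add:
  assumes "edge_lattice a" "edge_lattice b" shows "edge_lattice (\<lambda>v. a v + b v)"
proof -
  obtain m n where "\<forall>v\<in>cells \<phi> 0. a v = (\<Sum>e\<in>cells \<phi> 1. int (ends e v) * m e)"
    "\<forall>v\<in>cells \<phi> 0. b v = (\<Sum>e\<in>cells \<phi> 1. int (ends e v) * n e)"
    using assms unfolding edge_lattice_def by blast
  then have "\<forall>v\<in>cells \<phi> 0. a v + b v = (\<Sum>e\<in>cells \<phi> 1. int (ends e v) * (m e + n e))"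
    by (simp add: distrib_left sum.distrib)
  then show ?thesis unfolding edge_lattice_def by (rule exI[of _ "\<lambda>e. m e + n e"])
qed

lemma edge_lattice_scale:
  assumes "edge_lattice a" shows "edge_lattice (\<lambda>v. c * a v)"
proof -
  obtain m where "\<forall>v\<in>cells \<phi> 0. a v = (\<Sum>e\<in>cells \<phi> 1. int (ends e v) * m e)"
    using assms unfolding edge_lattice_def by blast
  then have "\<forall>v\<in>cells \<phi> 0. c * a v = (\<Sum>e\<in>cells \<phi> 1. int (ends e v) * (c * m e))"
    by (simp add: sum_distrib_left mult_ac)
  then show ?thesis unfolding edge_lattice_def by (rule exI[of _ "\<lambda>e. c * m e"])
qed

lemma edge_lattice_diff:
  assumes "edge_lattice a" "edge_lattice b" shows "edge_lattice (\<lambda>v. a v - b v)"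
  using edge_lattice_add[OF assms(1) edge_lattice_scale[OF assms(2), of "- 1"]] by simp

lemma edge_lattice_sum:
  assumes "finite A" "\<And>i. i \<in> A \<Longrightarrow> edge_lattice (f i)"
  shows "edge_lattice (\<lambda>v. \<Sum>i\<in>A. f i v)"
  using assms
proof (induction A rule: finite_induct)
  case empty
  have "edge_lattice (\<lambda>v. 0)" unfolding edge_lattice_def by (rule exI[of _ "\<lambda>e. 0"]) simp
  then show ?case by simp
next
  case (insert i A)
  then show ?case using edge_lattice_add[of "f i" "\<lambda>v. \<Sum>i\<in>A. f i v"] by simp
qed

lemma edge_lattice_edge:
  assumes "fst a = fst b" "a \<noteq> b"
  shows "edge_lattice (\<lambda>v. of_bool (cell {a} = v) + of_bool (cell {b} = v))"
proof -
  have "of_bool (cell {a} = v) + of_bool (cell {b} = v)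
      = (\<Sum>e\<in>cells \<phi> 1. int (ends e v) * of_bool (e = cell {a, b}))" if "v \<in> cells \<phi> 0" for v
  proof -
    have "(\<Sum>e\<in>cells \<phi> 1. int (ends e v) * of_bool (e = cell {a, b}))
        = (\<Sum>e\<in>cells \<phi> 1. if e = cell {a, b} then int (ends e v) else 0)"
      by (rule sum.cong) simp_all
    also have "\<dots> = int (ends (cell {a, b}) v)"
      using edge_in_cells[OF assms] by simp
    finally show ?thesis by (simp add: ends_edge[OF assms that])
  qed
  then show ?thesis unfolding edge_lattice_def by (intro exI[of _ "\<lambda>e. of_bool (e = cell {a, b})"]) blast
qed

text \<open>The difference of two vertices \<open>a\<close>, \<open>b\<close> of a tetrahedron is the edge \<open>ac\<close> minus the edge \<open>bc\<close>.\<close>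

lemma edge_lattice_same_tet:
  assumes "fst a = fst b"
  shows "edge_lattice (\<lambda>v. of_bool (cell {a} = v) - of_bool (cell {b} = v))"
proof -
  obtain c where c: "fst c = fst a" "c \<noteq> a" "c \<noteq> b" by (rule third_vertex[of a b])
  have "edge_lattice (\<lambda>v. of_bool (cell {a} = v) + of_bool (cell {c} = v))"
    "edge_lattice (\<lambda>v. of_bool (cell {b} = v) + of_bool (cell {c} = v))"
    by (rule edge_lattice_edge; use c assms in simp)+
  from edge_lattice_diff[OF this] show ?thesis by simp
qed

lemma edge_lattice_vertices:
  assumes conn: "connected_pairing \<phi>"
  shows "edge_lattice (\<lambda>v. of_bool (cell {a} = v) - of_bool (cell {b} = v))"
proof -
  define R where "R = {(u, u'). \<exists>f \<in> simplices 2. f \<subseteq> tet u \<and> \<phi> f ` f \<subseteq> tet u'}"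
  have "(fst a, fst b) \<in> R\<^sup>*"
    using conn unfolding connected_pairing_def R_def by blast
  moreover have "\<forall>b. fst b = u \<longrightarrow> edge_lattice (\<lambda>v. of_bool (cell {a} = v) - of_bool (cell {b} = v))"
    if "(fst a, u) \<in> R\<^sup>*" for u
    using that
  proof (induction rule: rtrancl_induct)
    case base
    then show ?case using edge_lattice_same_tet[of a] by simp
  next
    case (step u u')
    then obtain f where f: "f \<in> simplices 2" "f \<subseteq> tet u" "\<phi> f ` f \<subseteq> tet u'" unfolding R_def by blast
    have "f \<noteq> {}" using card_triangle[OF f(1)] by auto
    then obtain c where c: "c \<in> f" by blast
    show ?case
    proof (intro allI impI)
      fix b :: "'t vertex" assume b: "fst b = u'"
      have "fst c = u" "fst (\<phi> f c) = u'" using f c by auto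
      then have "edge_lattice (\<lambda>v. of_bool (cell {a} = v) - of_bool (cell {c} = v))"
        "edge_lattice (\<lambda>v. of_bool (cell {\<phi> f c} = v) - of_bool (cell {b} = v))"
        using step.IH[rule_format, of c] edge_lattice_same_tet[of "\<phi> f c" b] b by simp_all
      from edge_lattice_add[OF this] show "edge_lattice (\<lambda>v. of_bool (cell {a} = v) - of_bool (cell {b} = v))"
        by (simp add: cell_vertex[OF f(1) c])
    qed
  qed
  ultimately show ?thesis by blast
qed

text \<open>
  All differences of vertices are in the lattice, and so is twice the base vertex \<open>z\<close>, being an edge
  \<open>z + d\<close> minus the difference \<open>d - z\<close>.
\<close>

lemma edge_lattice_even:
  assumes conn: "connected_pairing \<phi>" and even: "even (\<Sum>v\<in>cells \<phi> 0. a v)"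
  shows "edge_lattice a"
proof -
  \<comment> \<open>an arbitrary corner; its cell \<open>z\<close> is the base vertex\<close>
  define c where "c = (undefined :: 't vertex)"
  define \<delta> where "\<delta> w v = (of_bool (w = v) :: int)" for w v :: "'t vertex set set"
  define z where "z = cell {c}"
  have diff: "edge_lattice (\<lambda>v. \<delta> w v - \<delta> z v)" if w: "w \<in> cells \<phi> 0" for w
  proof -
    obtain b where "w = cell {b}" using w unfolding cells_eq simplices_0 by blast
    then show ?thesis using edge_lattice_vertices[OF conn, of b c] by (simp add: \<delta>_def z_def)
  qed
  obtain d where d: "fst d = fst c" "d \<noteq> c" using third_vertex[of c c] by (metis (full_types))
  have "edge_lattice (\<lambda>v. \<delta> z v + \<delta> (cell {d}) v)"
    unfolding \<delta>_def z_def by (rule edge_lattice_edge) (use d in simp_all)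
  from edge_lattice_diff[OF this diff[OF vertex_in_cells[of d]]]
  have "edge_lattice (\<lambda>v. 2 * \<delta> z v)" by simp
  from edge_lattice_scale[OF this, of "(\<Sum>v\<in>cells \<phi> 0. a v) div 2"]
  have twice: "edge_lattice (\<lambda>v. (\<Sum>v\<in>cells \<phi> 0. a v) * \<delta> z v)" using even by (simp add: mult.assoc[symmetric])
  have "edge_lattice (\<lambda>v. (\<Sum>w\<in>cells \<phi> 0. a w * (\<delta> w v - \<delta> z v)) + (\<Sum>v\<in>cells \<phi> 0. a v) * \<delta> z v)"
    by (rule edge_lattice_add[OF edge_lattice_sum[OF finite edge_lattice_scale[OF diff]] twice])
  moreover have "(\<Sum>w\<in>cells \<phi> 0. a w * (\<delta> w v - \<delta> z v)) + (\<Sum>v\<in>cells \<phi> 0. a v) * \<delta> z v = a v"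
    if "v \<in> cells \<phi> 0" for v
  proof -
    have "(\<Sum>w\<in>cells \<phi> 0. a w * (\<delta> w v - \<delta> z v)) + (\<Sum>v\<in>cells \<phi> 0. a v) * \<delta> z v
        = (\<Sum>w\<in>cells \<phi> 0. a w * \<delta> w v)"
      by (simp add: right_diff_distrib sum_subtractf sum_distrib_right)
    also have "\<dots> = (\<Sum>w\<in>cells \<phi> 0. if w = v then a w else 0)"
      by (rule sum.cong) (simp_all add: \<delta>_def)
    also have "\<dots> = a v" using that by simp
    finally show ?thesis .
  qed
  ultimately show ?thesis unfolding edge_lattice_def by simp
qed

text \<open>The relation of a single vertex, evaluated on half turns for the tetrahedra.\<close>

lemma vertex_relation_axis_inner:
  assumes v: "v \<in> cells \<phi> 0" and y: "\<And>t. y $ Inl t = 1 / 2"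
  shows "vertex_relation (axis v 1) \<bullet> y
    = (\<Sum>e\<in>cells \<phi> 1. real (ends e v) * y $ Inr e) - real (card {c. cell {c} = v}) / 2"
proof -
  have "vertex_relation (axis v 1) \<bullet> y = (\<Sum>i\<in>UNIV. vertex_relation (axis v 1) $ i * y $ i)"
    by (simp add: inner_vec_def)
  also have "\<dots> = (\<Sum>t\<in>UNIV. vertex_relation (axis v 1) $ Inl t * y $ Inl t)
      + (\<Sum>e\<in>UNIV. vertex_relation (axis v 1) $ Inr e * y $ Inr e)"
    unfolding UNIV_Plus_UNIV[symmetric] by (subst sum.Plus) (simp_all add: comp_def)
  also have "(\<Sum>t\<in>UNIV. vertex_relation (axis v 1) $ Inl t * y $ Inl t)
      = - (\<Sum>t\<in>UNIV. \<Sum>i\<in>UNIV. of_bool (cell {(t, i)} = v)) / 2"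
    by (simp add: vertex_relation_def y sum_tet axis_def of_bool_def sum_divide_distrib sum_negf)
  also have "(\<Sum>t\<in>UNIV. \<Sum>i\<in>UNIV. of_bool (cell {(t, i)} = v)) = (\<Sum>c\<in>UNIV. of_bool (cell {c} = v) :: real)"
    unfolding sum.cartesian_product UNIV_Times_UNIV by (rule sum.cong) auto
  also have "\<dots> = real (card {c. cell {c} = v})"
    by simp
  also have "(\<Sum>e\<in>UNIV. vertex_relation (axis v 1) $ Inr e * y $ Inr e)
      = (\<Sum>e\<in>cells \<phi> 1. real (ends e v) * y $ Inr e)"
  proof (rule sum.mono_neutral_cong_right)
    fix e assume e: "e \<in> cells \<phi> 1"
    have "(\<Sum>w\<in>cells \<phi> 0. real (ends e w) * axis v 1 $ w) = (\<Sum>w\<in>cells \<phi> 0. if w = v then real (ends e w) else 0)"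
      by (rule sum.cong) (simp_all add: axis_def)
    also have "\<dots> = real (ends e v)" using v by simp
    finally show "vertex_relation (axis v 1) $ Inr e * y $ Inr e = real (ends e v) * y $ Inr e"
      using e by (simp add: vertex_relation_def)
  qed (simp_all add: vertex_relation_def)
  finally show ?thesis by simp
qed

lemma SAS_cis_iff:
  "(\<chi> q. cis (\<theta> $ q)) \<in> SAS \<phi> k \<longleftrightarrow> (\<forall>t. cis (angle_sums \<theta> $ Inl t) = - 1) \<and>
    (\<forall>e\<in>cells \<phi> 1. cis (angle_sums \<theta> $ Inr e) = k e)"
proof -
  have "(\<Prod>q\<in>UNIV. (\<chi> q. cis (\<theta> $ q)) $ (t, q)) = cis (angle_sums \<theta> $ Inl t)" for t
    by (simp add: angle_sums_def prod_cis)
  moreover have "(\<Prod>q\<in>UNIV. (\<chi> q. cis (\<theta> $ q)) $ q ^ quad_index q e) = cis (angle_sums \<theta> $ Inr e)"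
    if "e \<in> cells \<phi> 1" for e
    using that by (simp add: angle_sums_def) (simp only: Complex.DeMoivre prod_cis)
  ultimately show ?thesis by (simp add: SAS_def)
qed

lemma SAS_nonempty:
  assumes conn: "connected_pairing \<phi>"
    and k: "\<And>e. e \<in> cells \<phi> 1 \<Longrightarrow> k e \<in> sphere 0 1"
    and total: "(\<Prod>e\<in>cells \<phi> 1. k e) = 1"
    and vertex: "\<And>v. v \<in> cells \<phi> 0 \<Longrightarrow> (\<Prod>e\<in>cells \<phi> 1. k e ^ ends e v) = 1"
  shows "SAS \<phi> k \<noteq> {}"
proof -
  define \<eta> where "\<eta> e = Arg (k e) / (2 * pi)" for e
  have \<eta>: "k e = cis (2 * pi * \<eta> e)" if "e \<in> cells \<phi> 1" for e
  proof -
    have "norm (k e) = 1" using k[OF that] by simp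
    then have "k e \<noteq> 0" "sgn (k e) = k e" by (auto simp: sgn_div_norm)
    then show ?thesis using cis_Arg[of "k e"] by (simp add: \<eta>_def)
  qed
  have "cis (2 * pi * (\<Sum>e\<in>cells \<phi> 1. \<eta> e)) = (\<Prod>e\<in>cells \<phi> 1. k e)"
    by (simp add: \<eta> prod_cis sum_distrib_left)
  then have "cis (2 * pi * (\<Sum>e\<in>cells \<phi> 1. \<eta> e)) = 1" using total by simp
  then obtain N :: int where N: "(\<Sum>e\<in>cells \<phi> 1. \<eta> e) = of_int N" by (rule cis_2pi_eq_1E)
  \<comment> \<open>the defects, which have to vanish for the arguments to be angle sums\<close>
  define s where "s v = (\<Sum>e\<in>cells \<phi> 1. real (ends e v) * \<eta> e) - real (card {c. cell {c} = v}) / 2" for v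
  have s: "s v = of_int \<lfloor>s v\<rfloor>" if v: "v \<in> cells \<phi> 0" for v
  proof -
    have "cis (2 * pi * (\<Sum>e\<in>cells \<phi> 1. real (ends e v) * \<eta> e)) = (\<Prod>e\<in>cells \<phi> 1. k e ^ ends e v)"
      by (simp add: \<eta> Complex.DeMoivre prod_cis sum_distrib_left mult_ac)
    then have "cis (2 * pi * (\<Sum>e\<in>cells \<phi> 1. real (ends e v) * \<eta> e)) = 1" using vertex[OF v] by simp
    then obtain n :: int where n: "(\<Sum>e\<in>cells \<phi> 1. real (ends e v) * \<eta> e) = of_int n"
      by (rule cis_2pi_eq_1E)
    obtain l where "card {c. cell {c} = v} = 2 * l" using even_card_link by blast
    then have "s v = of_int (n - int l)" by (simp add: s_def n)
    then show ?thesis by simp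
  qed
  have "of_int (\<Sum>v\<in>cells \<phi> 0. \<lfloor>s v\<rfloor>) = (\<Sum>v\<in>cells \<phi> 0. s v)"
    unfolding of_int_sum by (rule sum.cong[OF refl s[symmetric]])
  also have "\<dots> = (\<Sum>v\<in>cells \<phi> 0. \<Sum>e\<in>cells \<phi> 1. real (ends e v) * \<eta> e)
      - real (\<Sum>v\<in>cells \<phi> 0. card {c. cell {c} = v}) / 2"
    by (simp add: s_def sum_subtractf sum_divide_distrib)
  also have "(\<Sum>v\<in>cells \<phi> 0. \<Sum>e\<in>cells \<phi> 1. real (ends e v) * \<eta> e) = 2 * of_int N"
  proof -
    have "(\<Sum>v\<in>cells \<phi> 0. \<Sum>e\<in>cells \<phi> 1. real (ends e v) * \<eta> e)
        = (\<Sum>e\<in>cells \<phi> 1. \<Sum>v\<in>cells \<phi> 0. real (ends e v) * \<eta> e)"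
      by (rule sum.swap)
    also have "\<dots> = (\<Sum>e\<in>cells \<phi> 1. 2 * \<eta> e)"
    proof (rule sum.cong[OF refl])
      fix e assume "e \<in> cells \<phi> 1"
      then obtain a b where ab: "fst a = fst b" "a \<noteq> b" "e = cell {a, b}"
        unfolding cells_eq simplices_1 by blast
      show "(\<Sum>v\<in>cells \<phi> 0. real (ends e v) * \<eta> e) = 2 * \<eta> e"
        unfolding ab(3) by (simp add: sum_ends[OF ab(1,2)])
    qed
    finally show ?thesis by (simp add: N sum_distrib_left[symmetric])
  qed
  also have "(\<Sum>v\<in>cells \<phi> 0. card {c. cell {c} = v}) = 4 * CARD('t)"
  proof -
    have "(\<Sum>v\<in>cells \<phi> 0. card {c. cell {c} = v}) = (\<Sum>v\<in>(\<lambda>c. cell {c}) ` UNIV. card {c \<in> UNIV. cell {c} = v})"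
      unfolding cells_eq simplices_0 by (simp add: image_image)
    also have "\<dots> = CARD('t vertex)"
      using sum.image_gen[of "UNIV :: 't vertex set" "\<lambda>_. 1 :: nat" "\<lambda>c. cell {c}"] by simp
    finally show ?thesis by simp
  qed
  finally have "of_int (\<Sum>v\<in>cells \<phi> 0. \<lfloor>s v\<rfloor>) = real_of_int (2 * (N - int CARD('t)))"
    by (simp add: algebra_simps)
  then have "even (\<Sum>v\<in>cells \<phi> 0. \<lfloor>s v\<rfloor>)" unfolding of_int_eq_iff by simp
  then obtain m where m: "\<And>v. v \<in> cells \<phi> 0 \<Longrightarrow> \<lfloor>s v\<rfloor> = (\<Sum>e\<in>cells \<phi> 1. int (ends e v) * m e)"
    using edge_lattice_even[OF conn, of "\<lambda>v. \<lfloor>s v\<rfloor>"] unfolding edge_lattice_def by blast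
  define y :: "real ^ ('t + 't vertex set set)" where
    "y = (\<chi> i. case i of Inl t \<Rightarrow> 1 / 2 | Inr e \<Rightarrow> if e \<in> cells \<phi> 1 then \<eta> e - of_int (m e) else 0)"
  have y_supp: "y \<in> supported" by (simp add: supported_def y_def)
  have y_orth: "vertex_relation (axis v 1) \<bullet> y = 0" if v: "v \<in> cells \<phi> 0" for v
  proof -
    have "vertex_relation (axis v 1) \<bullet> y
        = (\<Sum>e\<in>cells \<phi> 1. real (ends e v) * y $ Inr e) - real (card {c. cell {c} = v}) / 2"
      by (rule vertex_relation_axis_inner[OF v]) (simp add: y_def)
    also have "(\<Sum>e\<in>cells \<phi> 1. real (ends e v) * y $ Inr e)
        = (\<Sum>e\<in>cells \<phi> 1. real (ends e v) * \<eta> e) - of_int (\<Sum>e\<in>cells \<phi> 1. int (ends e v) * m e)"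
      by (simp add: y_def right_diff_distrib sum_subtractf)
    also have "of_int (\<Sum>e\<in>cells \<phi> 1. int (ends e v) * m e) = s v"
      using m[OF v] s[OF v] by simp
    finally show ?thesis by (simp add: s_def)
  qed
  obtain \<theta> where \<theta>: "angle_sums \<theta> = y" by (rule angle_sums_solvable[OF y_supp y_orth])
  have scaled: "angle_sums ((2 * pi) *\<^sub>R \<theta>) = (2 * pi) *\<^sub>R y"
    unfolding \<theta>[symmetric] by (rule linear_scale[OF linear_angle_sums])
  have "cis (2 * pi * (\<eta> e - of_int (m e))) = k e" if "e \<in> cells \<phi> 1" for e
  proof -
    have "cis (2 * pi * of_int (m e)) = 1" unfolding cis_eq_1_iff by blast
    then show ?thesis using \<eta>[OF that] by (simp add: right_diff_distrib cis_divide[symmetric])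
  qed
  then have "(\<chi> q. cis (((2 * pi) *\<^sub>R \<theta>) $ q)) \<in> SAS \<phi> k"
    unfolding SAS_cis_iff scaled by (simp add: y_def)
  then show ?thesis by blast
qed

end

section \<open>The manifold structure\<close>

lemma open_vec_component:
  assumes "\<And>q. open (S q)"
  shows "open {x :: 'a::topological_space ^ 'n. \<forall>q. x $ q \<in> S q}"
proof -
  have "{x :: 'a ^ 'n. \<forall>q. x $ q \<in> S q} = (\<Inter>q. (\<lambda>x. x $ q) -` S q)" by auto
  also have "open \<dots>"
    by (intro open_INT ballI open_vimage_vec_nth assms finite)
  finally show ?thesis .
qed

lemma smooth_on_imp_continuous_on: "smooth_on U f \<Longrightarrow> continuous_on U f"
  unfolding smooth_on_def by (drule spec[of _ 0]) simp

text \<open>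
  The logarithm, taken coordinatewise and relative to a base point \<open>p\<close>. The bound \<open>\<epsilon> \<le> pi\<close> keeps the
  strip away from the branch cut.
\<close>

lemma diffeomorphism_log:
  fixes p :: "complex ^ 'n"
  assumes p: "\<And>q. p $ q \<noteq> 0" and \<epsilon>: "\<epsilon> \<le> pi"
  defines "V \<equiv> {z. z \<notin> \<real>\<^sub>\<le>\<^sub>0 \<and> \<bar>Im (Ln z)\<bar> < \<epsilon>}"
  shows "diffeomorphism {x. \<forall>q. x $ q / p $ q \<in> V} {y. \<forall>q. \<bar>Im (y $ q)\<bar> < \<epsilon>}
    (\<lambda>x. \<chi> q. Ln (x $ q / p $ q)) (\<lambda>y. \<chi> q. p $ q * exp (y $ q))"
    (is "diffeomorphism ?U ?W ?f ?g")
proof -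
  have V: "open V"
  proof -
    have "V = (- \<real>\<^sub>\<le>\<^sub>0) \<inter> Ln -` {w. \<bar>Im w\<bar> < \<epsilon>}" unfolding V_def by auto
    moreover have "open {w. \<bar>Im w\<bar> < \<epsilon>}" by (intro open_Collect_less continuous_intros)
    moreover have "open (- \<real>\<^sub>\<le>\<^sub>0 :: complex set)"
      by (rule open_Compl[OF closed_nonpos_Reals_complex])
    moreover have "continuous_on (- \<real>\<^sub>\<le>\<^sub>0) Ln" by (intro continuous_on_Ln continuous_on_id) auto
    ultimately show ?thesis using continuous_open_preimage by metis
  qed
  have Vp: "open {z. z / p $ q \<in> V}" for q
  proof -
    have "open ((\<lambda>z. z / p $ q) -` V)"
      by (rule open_vimage[OF V]) (use p in \<open>intro continuous_intros; simp\<close>)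
    then show ?thesis by (simp add: vimage_def)
  qed
  have U: "open ?U" using open_vec_component[of "\<lambda>q. {z. z / p $ q \<in> V}", OF Vp] by simp
  have "open {w. \<bar>Im w\<bar> < \<epsilon>}" by (intro open_Collect_less continuous_intros)
  then have W: "open ?W" using open_vec_component[of "\<lambda>q. {w. \<bar>Im w\<bar> < \<epsilon>}"] by simp
  have f: "smooth_on ?U ?f"
  proof (rule smooth_on_coordinatewise_holomorphic[OF U Vp])
    show "(\<lambda>z. Ln (z / p $ q)) holomorphic_on {z. z / p $ q \<in> V}" for q
      by (intro holomorphic_intros) (use p in \<open>auto simp: V_def\<close>)
  qed simp
  have g: "smooth_on ?W ?g"
  proof (rule smooth_on_coordinatewise_holomorphic[OF W open_UNIV])
    show "(\<lambda>z. p $ q * exp z) holomorphic_on UNIV" for q by (intro holomorphic_intros)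
  qed simp
  have gf: "?g (?f x) = x" if "x \<in> ?U" for x
  proof -
    have "0 \<notin> V" by (simp add: V_def)
    then have "x $ q / p $ q \<noteq> 0" for q using that by (metis (mono_tags) mem_Collect_eq)
    then show ?thesis using p by (simp add: vec_eq_iff)
  qed
  have Ln_exp': "Ln (exp w) = w" if "\<bar>Im w\<bar> < \<epsilon>" for w
    using that \<epsilon> by (intro Ln_exp) auto
  have exp_V: "exp w \<in> V" if w: "\<bar>Im w\<bar> < \<epsilon>" for w
  proof -
    have nonpos: "Im (Ln z) = pi" if z: "z \<in> \<real>\<^sub>\<le>\<^sub>0" "z \<noteq> 0" for z
    proof -
      have "Re z \<le> 0" "Im z = 0" using z(1) by (simp_all add: complex_nonpos_Reals_iff)
      then have "Re z < 0" using z(2) by (auto simp: less_le complex_eq_iff)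
      then show ?thesis using Im_Ln_eq_pi[OF z(2)] \<open>Im z = 0\<close> by blast
    qed
    have "exp w \<notin> \<real>\<^sub>\<le>\<^sub>0" using nonpos[of "exp w"] Ln_exp'[OF w] w \<epsilon> by auto
    then show ?thesis using Ln_exp'[OF w] w by (simp add: V_def)
  qed
  have "homeomorphism ?U ?W ?f ?g"
  proof (rule homeomorphismI)
    show "continuous_on ?U ?f" using f by (rule smooth_on_imp_continuous_on)
    show "continuous_on ?W ?g" using g by (rule smooth_on_imp_continuous_on)
    show "?f ` ?U \<subseteq> ?W" by (auto simp: V_def)
    show "?g ` ?W \<subseteq> ?U" using p exp_V by auto
    show "?f (?g y) = y" if "y \<in> ?W" for y using that p Ln_exp' by (simp add: vec_eq_iff)
  qed (rule gf)
  then show ?thesis unfolding diffeomorphism_def using U W f g by blast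
qed

context paired_faces
begin

lemma norm_SAS: "x \<in> SAS \<phi> k \<Longrightarrow> norm (x $ q) = 1"
proof -
  assume "x \<in> SAS \<phi> k"
  then have "x $ q \<in> sphere 0 1" unfolding SAS_def by blast
  then show ?thesis by simp
qed

lemma compact_SAS: "compact (SAS \<phi> k)"
proof -
  have "SAS \<phi> k = (\<Inter>q. {x. norm (x $ q) = 1}) \<inter> (\<Inter>t. {x. (\<Prod>q\<in>UNIV. x $ (t, q)) = - 1})
      \<inter> (\<Inter>e\<in>cells \<phi> 1. {x. (\<Prod>q\<in>UNIV. x $ q ^ quad_index q e) = k e})"
    unfolding SAS_def by (auto simp: sphere_def dist_norm)
  moreover have "closed \<dots>"
    by (intro closed_Int closed_INT ballI closed_Collect_eq continuous_intros)
  ultimately have "closed (SAS \<phi> k)" by simp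
  moreover have "norm x \<le> real CARD('t \<times> quad)" if "x \<in> SAS \<phi> k" for x
  proof -
    have "norm x \<le> (\<Sum>q\<in>UNIV. norm (x $ q))"
      unfolding norm_vec_def by (rule L2_set_le_sum) simp
    also have "\<dots> = real CARD('t \<times> quad)" by (simp add: norm_SAS[OF that])
    finally show ?thesis .
  qed
  then have "bounded (SAS \<phi> k)" unfolding bounded_iff by blast
  ultimately show ?thesis by (simp add: compact_eq_bounded_closed)
qed

text \<open>
  Rotating an angle structure by angles \<open>\<theta>\<close> preserves its curvature and the conditions at the
  tetrahedra if and only if all angle sums of \<open>\<theta>\<close> are multiples of a full turn.
\<close>

lemma SAS_rotate:
  assumes p: "p \<in> SAS \<phi> k"
  shows "(\<chi> q. p $ q * cis (\<theta> $ q)) \<in> SAS \<phi> k \<longleftrightarrow> (\<forall>i. cis (angle_sums \<theta> $ i) = 1)"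
proof -
  let ?x = "\<chi> q. p $ q * cis (\<theta> $ q)"
  have norm_p: "norm (p $ q) = 1" for q using p by (rule norm_SAS)
  have tet: "(\<Prod>q\<in>UNIV. ?x $ (t, q)) = - cis (angle_sums \<theta> $ Inl t)" for t
    using p by (simp add: SAS_def angle_sums_def prod_cis prod.distrib)
  have edge: "(\<Prod>q\<in>UNIV. ?x $ q ^ quad_index q e) = k e * cis (angle_sums \<theta> $ Inr e)"
    if e: "e \<in> cells \<phi> 1" for e
  proof -
    have "(\<Prod>q\<in>UNIV. p $ q ^ quad_index q e) = k e" using p e unfolding SAS_def by blast
    moreover have "(\<Prod>q\<in>UNIV. cis (\<theta> $ q) ^ quad_index q e) = cis (angle_sums \<theta> $ Inr e)"
      using e by (simp add: angle_sums_def Complex.DeMoivre prod_cis)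
    ultimately show ?thesis by (simp add: power_mult_distrib prod.distrib)
  qed
  have "k e \<noteq> 0" if e: "e \<in> cells \<phi> 1" for e
  proof -
    have "(\<Prod>q\<in>UNIV. p $ q ^ quad_index q e) = k e" using p e unfolding SAS_def by blast
    moreover have "p $ q \<noteq> 0" for q using norm_p[of q] by auto
    ultimately show ?thesis by (metis (no_types, lifting) finite power_not_zero prod_zero_iff)
  qed
  moreover have "cis (angle_sums \<theta> $ Inr e) = 1" if "e \<notin> cells \<phi> 1" for e
    using that by (simp add: angle_sums_def)
  ultimately have "(\<forall>i. cis (angle_sums \<theta> $ i) = 1) \<longleftrightarrow>
      (\<forall>t. (\<Prod>q\<in>UNIV. ?x $ (t, q)) = - 1) \<and> (\<forall>e\<in>cells \<phi> 1. (\<Prod>q\<in>UNIV. ?x $ q ^ quad_index q e) = k e)"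
    unfolding split_sum_all tet using edge by auto
  moreover have "?x $ q \<in> sphere 0 1" for q using norm_p by (simp add: norm_mult)
  ultimately show ?thesis unfolding SAS_def by blast
qed

lemma small_angle_sums:
  obtains \<epsilon> where "0 < \<epsilon>" "\<epsilon> \<le> pi"
    "\<And>\<theta> i. (\<And>q. \<bar>\<theta> $ q\<bar> < \<epsilon>) \<Longrightarrow> \<bar>angle_sums \<theta> $ i\<bar> < 2 * pi"
proof -
  obtain B where B: "B > 0" "\<And>\<theta>. norm (angle_sums \<theta>) \<le> B * norm \<theta>"
    using linear_bounded_pos[OF linear_angle_sums] by blast
  let ?N = "real CARD('t \<times> quad)"
  have N: "?N > 0" using zero_less_card_finite by (simp only: of_nat_0_less_iff)
  define \<epsilon> where "\<epsilon> = min pi (pi / (B * ?N))"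
  show ?thesis
  proof
    show "0 < \<epsilon>" "\<epsilon> \<le> pi" using B(1) N by (simp_all only: \<epsilon>_def min_less_iff_conj pi_gt_zero divide_pos_pos mult_pos_pos min.cobounded1)
    fix \<theta> :: "real ^ ('t \<times> quad)" and i assume \<theta>: "\<And>q. \<bar>\<theta> $ q\<bar> < \<epsilon>"
    have "norm \<theta> \<le> (\<Sum>q\<in>UNIV. \<bar>\<theta> $ q\<bar>)" by (rule norm_le_l1_cart)
    also have "\<dots> \<le> (\<Sum>q\<in>(UNIV :: ('t \<times> quad) set). pi / (B * ?N))"
      by (rule sum_mono) (use \<theta> in \<open>simp add: \<epsilon>_def less_imp_le\<close>)
    also have "\<dots> = ?N * (pi / (B * ?N))" by (simp only: sum_constant)
    also have "\<dots> = pi / B" using N by simp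
    finally have "B * norm \<theta> \<le> pi" using B(1) by (simp add: pos_le_divide_eq mult.commute)
    moreover have "\<bar>angle_sums \<theta> $ i\<bar> \<le> norm (angle_sums \<theta>)" by (rule component_le_norm_cart)
    ultimately show "\<bar>angle_sums \<theta> $ i\<bar> < 2 * pi" using B(2)[of \<theta>] pi_gt_zero by linarith
  qed
qed

text \<open>
  In the logarithmic chart at \<open>p\<close>, the points of \<open>SAS \<phi> k\<close> have vanishing real part since all
  coordinates have norm 1, and the imaginary part satisfies the linear system exactly, not only up to
  multiples of a full turn.
\<close>

lemma SAS_smooth_submanifold:
  "smooth_submanifold (dim {\<theta>. angle_sums \<theta> = 0}) (SAS \<phi> k)"
  unfolding smooth_submanifold_def
proof
  fix p assume p: "p \<in> SAS \<phi> k"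
  obtain \<epsilon> where \<epsilon>: "0 < \<epsilon>" "\<epsilon> \<le> pi"
    and small: "\<And>\<theta> i. (\<And>q. \<bar>\<theta> $ q\<bar> < \<epsilon>) \<Longrightarrow> \<bar>angle_sums \<theta> $ i\<bar> < 2 * pi"
    using small_angle_sums by blast
  have norm_p: "norm (p $ q) = 1" for q using p by (rule norm_SAS)
  then have p0: "p $ q \<noteq> 0" for q by (metis norm_zero zero_neq_one)
  define V where "V = {z. z \<notin> \<real>\<^sub>\<le>\<^sub>0 \<and> \<bar>Im (Ln z)\<bar> < \<epsilon>}"
  define U where "U = {x. \<forall>q. x $ q / p $ q \<in> V}"
  define W where "W = {y :: complex ^ ('t \<times> quad). \<forall>q. \<bar>Im (y $ q)\<bar> < \<epsilon>}"
  define f where "f x = (\<chi> q. Ln (x $ q / p $ q))" for x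
  define g where "g y = (\<chi> q. p $ q * exp (y $ q))" for y
  have diffeo: "diffeomorphism U W f g"
    unfolding U_def W_def f_def g_def V_def using p0 \<epsilon>(2) by (rule diffeomorphism_log)
  then have homeo: "homeomorphism U W f g" by (simp add: diffeomorphism_def)
  define J where "J \<theta> = (\<chi> q. \<i> * of_real (\<theta> $ q))" for \<theta> :: "real ^ ('t \<times> quad)"
  have J: "linear J"
    by (rule linearI) (simp_all add: J_def vec_eq_iff complex_eq_iff)
  have inj_J: "inj J" by (rule injI) (simp add: J_def vec_eq_iff)
  define K where "K = {\<theta>. angle_sums \<theta> = 0}"
  have K: "subspace K" unfolding K_def by (rule linear_subspace_kernel[OF linear_angle_sums])
  have gJ: "g (J \<theta>) = (\<chi> q. p $ q * cis (\<theta> $ q))" for \<theta>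
    by (simp add: g_def J_def cis_conv_exp)
  have JW: "J \<theta> \<in> W \<longleftrightarrow> (\<forall>q. \<bar>\<theta> $ q\<bar> < \<epsilon>)" for \<theta>
    by (simp add: J_def W_def)
  have kernel: "g (J \<theta>) \<in> SAS \<phi> k \<longleftrightarrow> \<theta> \<in> K" if \<theta>: "J \<theta> \<in> W" for \<theta>
  proof -
    have "cis (angle_sums \<theta> $ i) = 1 \<longleftrightarrow> angle_sums \<theta> $ i = 0" for i
    proof
      assume "cis (angle_sums \<theta> $ i) = 1"
      then obtain n :: int where n: "angle_sums \<theta> $ i = 2 * pi * of_int n"
        using cis_eq_1_iff by blast
      have "\<bar>angle_sums \<theta> $ i\<bar> < 2 * pi" using small \<theta> JW by blast
      then have "2 * pi * \<bar>real_of_int n\<bar> < 2 * pi * 1" using n by (simp add: abs_mult)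
      then have "\<bar>real_of_int n\<bar> < 1" using mult_less_cancel_left_pos[of "2 * pi" "\<bar>real_of_int n\<bar>" 1] by simp
      then have "n = 0" by linarith
      then show "angle_sums \<theta> $ i = 0" using n by simp
    qed simp
    then show ?thesis unfolding gJ SAS_rotate[OF p] K_def by (simp add: vec_eq_iff)
  qed
  have "f ` (SAS \<phi> k \<inter> U) = J ` K \<inter> W"
  proof (intro equalityI subsetI)
    fix y assume "y \<in> f ` (SAS \<phi> k \<inter> U)"
    then obtain x where x: "x \<in> SAS \<phi> k" "x \<in> U" "y = f x" by blast
    have "norm (x $ q / p $ q) = 1" for q by (simp add: norm_divide norm_p norm_SAS[OF x(1)])
    moreover have "x $ q / p $ q \<noteq> 0" for q
    proof -
      have "x $ q / p $ q \<in> V" using x(2) unfolding U_def by blast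
      moreover have "0 \<notin> V" by (simp add: V_def)
      ultimately show ?thesis by metis
    qed
    ultimately have "Re (y $ q) = 0" for q unfolding x(3) f_def by simp
    then have y: "y = J (\<chi> q. Im (y $ q))" by (simp add: J_def vec_eq_iff complex_eq_iff)
    have yW: "y \<in> W" and gy: "g y = x" using homeo x unfolding homeomorphism_def by blast+
    have "(\<chi> q. Im (y $ q)) \<in> K" using kernel[of "\<chi> q. Im (y $ q)"] y yW gy x(1) by simp
    then show "y \<in> J ` K \<inter> W" using y yW by blast
  next
    fix y assume "y \<in> J ` K \<inter> W"
    then obtain \<theta> where \<theta>: "\<theta> \<in> K" "y = J \<theta>" "y \<in> W" by blast
    then have "g y \<in> SAS \<phi> k" using kernel by blast
    moreover have "g y \<in> U" "f (g y) = y" using homeo \<theta>(3) unfolding homeomorphism_def by blast+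
    ultimately show "y \<in> f ` (SAS \<phi> k \<inter> U)" by (metis IntI image_eqI)
  qed
  moreover have "p \<in> U"
    using p0 \<epsilon>(1) by (simp add: U_def V_def)
  moreover have "subspace (J ` K)" using J K by (rule linear_subspace_image)
  moreover have "dim (J ` K) = dim {\<theta>. angle_sums \<theta> = 0}"
    unfolding K_def[symmetric] using inj_J by (intro dim_image_eq J) (rule inj_on_subset[OF _ subset_UNIV])
  ultimately show "\<exists>U (W :: (complex ^ ('t \<times> quad)) set) L f g. p \<in> U \<and> diffeomorphism U W f g \<and> subspace L
      \<and> dim L = dim {\<theta>. angle_sums \<theta> = 0} \<and> f ` (SAS \<phi> k \<inter> U) = L \<inter> W"
    using diffeo by blast
qed

end

theorem proposition2p6:
  fixes \<phi> :: "'t::finite pairing"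
    and k :: "'t vertex set set \<Rightarrow> complex"
  assumes "triangulated_closed_pseudo_3_manifold \<phi>"
    and "\<And>e. e \<in> cells \<phi> 1 \<Longrightarrow> k e \<in> sphere 0 1"
    and "(\<Prod>e \<in> cells \<phi> 1. k e) = 1"
    and "\<And>v. v \<in> cells \<phi> 0 \<Longrightarrow> (\<Prod>e \<in> cells \<phi> 1. k e ^ ends e v) = 1"
  shows "SAS \<phi> k \<noteq> {} \<and>
    smooth_closed_manifold (nat \<bar>euler_char \<phi>\<bar> + CARD('t)) (SAS \<phi> k)"
proof -
  have \<phi>: "face_pairing \<phi>" "connected_pairing \<phi>" "unfolded_edges \<phi>"
    using assms(1) by (simp_all add: triangulated_closed_pseudo_3_manifold_def)
  interpret paired_faces \<phi> by standard (rule \<phi>(1))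
  have "int (dim {\<theta>. angle_sums \<theta> = 0}) + int (card (cells \<phi> 1)) = 2 * int CARD('t) + int (card (cells \<phi> 0))"
    using arg_cong[OF dim_kernel_angle_sums, of int] by simp
  moreover have "euler_char \<phi> \<ge> 0"
    using card_edges_le[OF \<phi>(3)] unfolding euler_char_eq by linarith
  ultimately have "dim {\<theta>. angle_sums \<theta> = 0} = nat \<bar>euler_char \<phi>\<bar> + CARD('t)"
    unfolding euler_char_eq by linarith
  then have "smooth_closed_manifold (nat \<bar>euler_char \<phi>\<bar> + CARD('t)) (SAS \<phi> k)"
    unfolding smooth_closed_manifold_def using compact_SAS SAS_smooth_submanifold by metis
  moreover have "SAS \<phi> k \<noteq> {}"
    using \<phi>(2) assms(2-4) by (rule SAS_nonempty)
  ultimately show ?thesis by blast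
qed

end
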